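(* Let $\bar\varphi=(\varphi_0,\varphi)$ be an affine equilibrium of an LQG game $(w,b,c,\mathcal P)$, $\mathcal P=(P,P_\theta)$ with signal dimension $\bar d$, that is payoff-symmetric: $w(i,j)=a$ for almost every $(i,j)\in[0,1]^2$, where $a<1$ is a constant. Let $q(i)=\sigma_\theta b(i)P_\theta(i)\in\mathbb R^{\bar d}$ for $i\in[0,1]$. (i) If $0\le a<1$, then $$\int_0^1\|\varphi(i)\|^2\,di\ \ge\ \int_0^1\|q(i)\|^2\,di,$$ with equality if $a=0$ or if $\int_0^1P(i,j)q(j)\,dj=0$ for almost every $i\in[0,1]$. (ii) If $a<0$, then $$\int_0^1\|\varphi(i)\|^2\,di\ \ge\ \Bigl(\frac1{1-a}\Bigr)^2\int_0^1\|q(i)\|^2\,di,$$ with equality if $\int_0^1P(i,j)q(j)\,dj=q(i)$ for almost every $i\in[0,1]$.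
   Context: Fix $\mu_\theta\in\mathbb R$ and $\sigma_\theta>0$. Agents are indexed by $[0,1]$ with Lebesgue measure. Payoff structure: $(w,b,c)$ with $w:[0,1]^2\to\mathbb R$, $b,c:[0,1]\to\mathbb R$ measurable and square-integrable, and $w(i,\cdot)$ square-integrable for every $i$. Information structure: $\{\theta\}\cup\{S_1(i),\dots,S_{\bar d}(i)\}_{i\in[0,1]}$ is a Gaussian process (finite subcollections multivariate normal, possibly degenerate) with $\theta\sim\mathcal N(\mu_\theta,\sigma_\theta^2)$; $S(i)=(S_1(i),\dots,S_{\bar d}(i))^\top$, $K(i,j)=\mathrm{Cov}[S(i),S(j)]$, $K_\theta(i)=\mathrm{Cov}[S(i),\theta]$, $K(i,i)$ invertible for every $i$; $P(i,j)=K(i,i)^{-1/2}K(i,j)K(j,j)^{-1/2}$ and $P_\theta(i)=\sigma_\theta^{-1}K(i,i)^{-1/2}K_\theta(i)$ (symmetric square roots), assumed measurable ($P$ jointly and in each variable). Write $\mathcal P=(P,P_\theta)$. An affine equilibrium of $(w,b,c,\mathcal P)$ is $\bar\varphi=(\varphi_0,\varphi):[0,1]\to\mathbb R\times\mathbb R^{\bar d}$ with square-integrable components such that for every $i$: $\varphi_0(i)=\int_0^1w(i,j)\varphi_0(j)dj+\mu_\theta b(i)+c(i)$ and $\varphi(i)=\int_0^1w(i,j)P(i,j)\varphi(j)dj+\sigma_\theta b(i)P_\theta(i)$. (Then $\|\varphi(i)\|^2$ is the variance of agent $i$'s equilibrium action.) $\|\cdot\|$ is the Euclidean norm. *)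

theory Defs
  imports "HOL-Probability.Probability"
begin

abbreviation agents :: "real measure" where
  "agents \<equiv> lebesgue_on {0..1}"

(* The completed product measure on the unit square; sections of functions that are
   measurable with respect to it need not be measurable. *)
abbreviation agent_pairs :: "(real \<times> real) measure" where
  "agent_pairs \<equiv> lebesgue_on ({0..1} \<times> {0..1})"

definition square_integrable :: "'a measure \<Rightarrow> ('a \<Rightarrow> real) \<Rightarrow> bool" where
  "square_integrable N f \<longleftrightarrow> f \<in> borel_measurable N \<and> integrable N (\<lambda>x. (f x)\<^sup>2)"


definition covariance :: "'w measure \<Rightarrow> ('w \<Rightarrow> real) \<Rightarrow> ('w \<Rightarrow> real) \<Rightarrow> real" where
  "covariance M X Y =
     (\<integral>\<omega>. (X \<omega> - (\<integral>\<omega>'. X \<omega>' \<partial>M)) * (Y \<omega> - (\<integral>\<omega>'. Y \<omega>' \<partial>M)) \<partial>M)"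

(* The second disjunct is the degenerate case of variance zero. *)
definition normal_variable :: "'w measure \<Rightarrow> ('w \<Rightarrow> real) \<Rightarrow> bool" where
  "normal_variable M X \<longleftrightarrow>
     (\<exists>\<mu> \<sigma>. 0 < \<sigma> \<and> distributed M lborel X (normal_density \<mu> \<sigma>)) \<or>
     (X \<in> borel_measurable M \<and> (\<exists>\<mu>. AE \<omega> in M. X \<omega> = \<mu>))"

(* A possibly degenerate multivariate normal family: all linear combinations are normal. *)
definition multivariate_normal :: "'w measure \<Rightarrow> 'i set \<Rightarrow> ('i \<Rightarrow> 'w \<Rightarrow> real) \<Rightarrow> bool" where
  "multivariate_normal M F X \<longleftrightarrow> (\<forall>u. normal_variable M (\<lambda>\<omega>. \<Sum>i\<in>F. u i * X i \<omega>))"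

definition gaussian_process :: "'w measure \<Rightarrow> 'i set \<Rightarrow> ('i \<Rightarrow> 'w \<Rightarrow> real) \<Rightarrow> bool" where
  "gaussian_process M I X \<longleftrightarrow> (\<forall>F. finite F \<and> F \<subseteq> I \<longrightarrow> multivariate_normal M F X)"

datatype 'd variable_index = State | Signal real 'd

fun all_variables ::
  "('w \<Rightarrow> real) \<Rightarrow> (real \<Rightarrow> 'w \<Rightarrow> real ^ 'd) \<Rightarrow> 'd variable_index \<Rightarrow> 'w \<Rightarrow> real" where
  "all_variables \<theta> S State = \<theta>"
| "all_variables \<theta> S (Signal i k) = (\<lambda>\<omega>. S i \<omega> $ k)"


definition pos_semidef_matrix :: "real ^ 'n ^ 'n \<Rightarrow> bool" where
  "pos_semidef_matrix A \<longleftrightarrow> transpose A = A \<and> (\<forall>x. 0 \<le> x \<bullet> (A *v x))"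

(* Used only for symmetric positive semidefinite A, where exactly one such R exists. *)
definition matrix_sqrt :: "real ^ 'n ^ 'n \<Rightarrow> real ^ 'n ^ 'n" where
  "matrix_sqrt A = (THE R. pos_semidef_matrix R \<and> R ** R = A)"

definition signal_cov ::
  "'w measure \<Rightarrow> (real \<Rightarrow> 'w \<Rightarrow> real ^ 'd) \<Rightarrow> real \<Rightarrow> real \<Rightarrow> real ^ 'd ^ 'd" where
  "signal_cov M S i j = (\<chi> k l. covariance M (\<lambda>\<omega>. S i \<omega> $ k) (\<lambda>\<omega>. S j \<omega> $ l))"

definition state_cov ::
  "'w measure \<Rightarrow> ('w \<Rightarrow> real) \<Rightarrow> (real \<Rightarrow> 'w \<Rightarrow> real ^ 'd) \<Rightarrow> real \<Rightarrow> real ^ 'd" where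
  "state_cov M \<theta> S i = (\<chi> k. covariance M (\<lambda>\<omega>. S i \<omega> $ k) \<theta>)"

definition signal_corr ::
  "'w measure \<Rightarrow> (real \<Rightarrow> 'w \<Rightarrow> real ^ 'd) \<Rightarrow> real \<Rightarrow> real \<Rightarrow> real ^ 'd ^ 'd" where
  "signal_corr M S i j =
     matrix_sqrt (matrix_inv (signal_cov M S i i)) ** signal_cov M S i j
       ** matrix_sqrt (matrix_inv (signal_cov M S j j))"

definition state_corr ::
  "'w measure \<Rightarrow> real \<Rightarrow> ('w \<Rightarrow> real) \<Rightarrow> (real \<Rightarrow> 'w \<Rightarrow> real ^ 'd) \<Rightarrow> real \<Rightarrow> real ^ 'd" where
  "state_corr M \<sigma>\<^sub>\<theta> \<theta> S i =
     (1 / \<sigma>\<^sub>\<theta>) *\<^sub>R (matrix_sqrt (matrix_inv (signal_cov M S i i)) *v state_cov M \<theta> S i)"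

definition information_structure ::
  "'w measure \<Rightarrow> real \<Rightarrow> real \<Rightarrow> ('w \<Rightarrow> real) \<Rightarrow> (real \<Rightarrow> 'w \<Rightarrow> real ^ 'd) \<Rightarrow> bool" where
  "information_structure M \<mu>\<^sub>\<theta> \<sigma>\<^sub>\<theta> \<theta> S \<longleftrightarrow>
     prob_space M \<and>
     gaussian_process M (insert State {Signal i k | i k. i \<in> {0..1}}) (all_variables \<theta> S) \<and>
     distributed M lborel \<theta> (normal_density \<mu>\<^sub>\<theta> \<sigma>\<^sub>\<theta>) \<and>
     (\<forall>i\<in>{0..1}. invertible (signal_cov M S i i)) \<and>
     (\<lambda>(i, j). signal_corr M S i j) \<in> borel_measurable agent_pairs \<and>
     (\<forall>i\<in>{0..1}. (\<lambda>j. signal_corr M S i j) \<in> borel_measurable agents) \<and>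
     (\<forall>j\<in>{0..1}. (\<lambda>i. signal_corr M S i j) \<in> borel_measurable agents) \<and>
     state_corr M \<sigma>\<^sub>\<theta> \<theta> S \<in> borel_measurable agents"


definition payoff_structure ::
  "(real \<Rightarrow> real \<Rightarrow> real) \<Rightarrow> (real \<Rightarrow> real) \<Rightarrow> (real \<Rightarrow> real) \<Rightarrow> bool" where
  "payoff_structure w b c \<longleftrightarrow>
     square_integrable agent_pairs (\<lambda>(i, j). w i j) \<and>
     (\<forall>i\<in>{0..1}. square_integrable agents (w i)) \<and>
     square_integrable agents b \<and> square_integrable agents c"

definition affine_equilibrium ::
  "real \<Rightarrow> real \<Rightarrow> (real \<Rightarrow> real \<Rightarrow> real) \<Rightarrow> (real \<Rightarrow> real) \<Rightarrow> (real \<Rightarrow> real) \<Rightarrow>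
   (real \<Rightarrow> real \<Rightarrow> real ^ 'd ^ 'd) \<Rightarrow> (real \<Rightarrow> real ^ 'd) \<Rightarrow>
   (real \<Rightarrow> real) \<Rightarrow> (real \<Rightarrow> real ^ 'd) \<Rightarrow> bool" where
  "affine_equilibrium \<mu>\<^sub>\<theta> \<sigma>\<^sub>\<theta> w b c P P\<^sub>\<theta> \<phi>\<^sub>0 \<phi> \<longleftrightarrow>
     square_integrable agents \<phi>\<^sub>0 \<and>
     (\<forall>k. square_integrable agents (\<lambda>i. \<phi> i $ k)) \<and>
     (\<forall>i\<in>{0..1}.
        \<phi>\<^sub>0 i = (\<integral>j. w i j * \<phi>\<^sub>0 j \<partial>agents) + \<mu>\<^sub>\<theta> * b i + c i \<and>
        \<phi> i = (\<integral>j. w i j *\<^sub>R (P i j *v \<phi> j) \<partial>agents) + (\<sigma>\<^sub>\<theta> * b i) *\<^sub>R P\<^sub>\<theta> i)"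

definition payoff_symmetric :: "(real \<Rightarrow> real \<Rightarrow> real) \<Rightarrow> real \<Rightarrow> bool" where
  "payoff_symmetric w a \<longleftrightarrow> (AE (i, j) in agent_pairs. w i j = a) \<and> a < 1"

end

(* The correlation matrices P(i,j) define an operator T f (i) = \<integral> P(i,j) f(j) dj on
   L^2([0,1]; R^d). Its quadratic form is a limit of variances of linear combinations of
   signals, so T is symmetric and positive, and P(i,i) = 1 forces T \<le> 1, hence T^2 \<le> T.
   Under payoff symmetry the equilibrium condition reads q = (1 - aT) \<phi> almost everywhere,
   and both inequalities are norm bounds for 1 - aT. If T q = l q with l in [0,1], then
   \<phi> = q / (1 - a l) because 1 - aT is injective for a < 1; the equality cases are l = 0, 1. *)
theory Submission
  imports Defs
begin

text \<open>Positivity of \<open>P\<close> is known at every finite set of points, whereas an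
  integral over the square sees \<open>P\<close> only up to null sets, and \<open>P\<close> is
  measurable there only for the completed measure. Independent sampling reconciles the two: pairs of
  sample points with different indices almost surely avoid the exceptional set, and the diagonal
  blocks are identities by normalisation. The bound T \<le> 1 starts from positivity at two points,
  which makes every P(i,j) a contraction. In place of a spectral decomposition of T, the proof uses
  ||q||^2 = ||\<phi>||^2 - 2 a <\<phi>, T \<phi>> + a^2 ||T \<phi>||^2 together with the chain 0
  \<le> ||T \<phi>||^2 \<le> <\<phi>, T \<phi>> \<le> ||\<phi>||^2. The finite-dimensional spectral
  theorem comes in because \<open>matrix_sqrt\<close> is a definite description: it says nothing
  until existence and uniqueness of the root are established.\<close>

section \<open>Square roots of positive semidefinite matrices\<close>

text \<open>A maximiser of the Rayleigh quotient on the compact unit sphere of \<open>V\<close> is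
  an eigenvector. The invariant subspace \<open>V\<close> is a parameter so that an orthogonal
  complement can be inserted later.\<close>

lemma symmetric_map_eigenvector_in_subspace:
  fixes f :: "'a::euclidean_space \<Rightarrow> 'a"
  assumes f: "linear f" and sym: "\<And>x y. x \<bullet> f y = f x \<bullet> y"
    and V: "subspace V" and inv: "\<And>x. x \<in> V \<Longrightarrow> f x \<in> V" and ne: "V \<noteq> {0}"
  obtains v l where "v \<in> V" "v \<noteq> 0" "f v = l *\<^sub>R v"
proof -
  define K where "K = V \<inter> sphere 0 1"
  obtain u where u: "u \<in> V" "u \<noteq> 0"
    using ne subspace_0[OF V] by blast
  have "compact K"
    unfolding K_def using closed_subspace[OF V] compact_sphere by (blast intro: closed_Int_compact)
  moreover have "(1 / norm u) *\<^sub>R u \<in> K"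
    using u V by (simp add: K_def subspace_scale)
  moreover have "continuous_on K (\<lambda>x. x \<bullet> f x)"
    using f by (intro continuous_intros linear_continuous_on linear_linear[THEN iffD2]) (auto simp: linear_conv_bounded_linear)
  ultimately obtain v where v: "v \<in> K" and vmax: "\<And>x. x \<in> K \<Longrightarrow> x \<bullet> f x \<le> v \<bullet> f v"
    using continuous_attains_sup[of K "\<lambda>x. x \<bullet> f x"] by blast
  define l where "l = v \<bullet> f v"
  have vV: "v \<in> V" and nv: "norm v = 1" and v0: "v \<noteq> 0"
    using v by (auto simp: K_def)
  \<comment> \<open>Both sides are homogeneous of degree 2, so the maximum on the sphere controls
    all of \<open>V\<close>.\<close>
  have le: "x \<bullet> f x \<le> l * (norm x)\<^sup>2" if "x \<in> V" for x
  proof (cases "x = 0")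
    case False
    have "(1 / norm x) *\<^sub>R x \<in> K"
      using that False V by (simp add: K_def subspace_scale)
    from vmax[OF this] have "(1 / norm x) * ((1 / norm x) * (x \<bullet> f x)) \<le> l"
      by (simp add: l_def linear_scale[OF f])
    then show ?thesis
      using False by (simp add: field_simps power2_eq_square)
  qed (use linear_0[OF f] in auto)
  \<comment> \<open>The residual of the eigenvalue equation. It is orthogonal to \<open>v\<close>
    because \<open>l\<close> is the Rayleigh quotient of the unit vector \<open>v\<close>.\<close>
  define z where "z = f v - l *\<^sub>R v"
  have zV: "z \<in> V"
    using V inv vV by (simp add: z_def subspace_diff subspace_scale)
  have vv: "v \<bullet> v = 1"
    using nv by (simp add: dot_square_norm)
  have vz: "v \<bullet> z = 0"
    by (simp add: z_def inner_diff_right vv l_def[symmetric])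
  have zz: "z \<bullet> f v = z \<bullet> z"
    using vz by (simp add: z_def inner_diff_right inner_commute algebra_simps)
  (* First-order condition: moving from the maximiser in the direction z raises the
     Rayleigh quotient unless z = 0. *)
  have key: "2 * t * (z \<bullet> z) \<le> t\<^sup>2 * (l * (z \<bullet> z) - z \<bullet> f z)" for t
  proof -
    have "(v + t *\<^sub>R z) \<bullet> f (v + t *\<^sub>R z) \<le> l * (norm (v + t *\<^sub>R z))\<^sup>2"
      using vV zV V by (intro le) (simp add: subspace_add subspace_scale)
    moreover have "(v + t *\<^sub>R z) \<bullet> f (v + t *\<^sub>R z) = l + 2 * t * (z \<bullet> z) + t\<^sup>2 * (z \<bullet> f z)"
      using zz sym[of v z] by (simp add: linear_add[OF f] linear_scale[OF f] inner_add_left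
          inner_add_right l_def inner_commute power2_eq_square algebra_simps)
    moreover have "(norm (v + t *\<^sub>R z))\<^sup>2 = 1 + t\<^sup>2 * (z \<bullet> z)"
      using vz vv unfolding power2_norm_eq_inner
      by (simp add: inner_add_left inner_add_right inner_commute power2_eq_square)
    ultimately show ?thesis
      by (simp add: algebra_simps)
  qed
  define C where "C = l * (z \<bullet> z) - z \<bullet> f z"
  have "z \<bullet> z \<le> 0"
  proof (rule ccontr)
    assume "\<not> z \<bullet> z \<le> 0"
    then have p: "z \<bullet> z > 0" by linarith
    \<comment> \<open>Small enough that t * C \<le> z \<bullet> z, while \<open>key\<close> demands
      2 * (z \<bullet> z) \<le> t * C; the added 1 keeps the denominator positive.\<close>
    define t where "t = (z \<bullet> z) / (\<bar>C\<bar> + 1)"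
    have t: "t > 0" using p by (simp add: t_def)
    have "t * (2 * (z \<bullet> z)) \<le> t * (t * C)"
      using key[of t] by (simp add: C_def power2_eq_square algebra_simps)
    then have "2 * (z \<bullet> z) \<le> t * C" using t by simp
    also have "\<dots> \<le> t * (\<bar>C\<bar> + 1)" using t by simp
    also have "\<dots> = z \<bullet> z" by (simp add: t_def)
    finally show False using p by simp
  qed
  then have "z = 0"
    using inner_ge_zero[of z] inner_eq_zero_iff[of z] by linarith
  then show thesis
    using that[of v l] vV v0 by (simp add: z_def)
qed

text \<open>By symmetry the orthogonal complement of the span is invariant. If it were nonzero, it
  would contain an eigenvector, which would then be orthogonal to itself.\<close>

lemma symmetric_map_eigenvectors_span:
  fixes f :: "'a::euclidean_space \<Rightarrow> 'a"
  assumes f: "linear f" and sym: "\<And>x y. x \<bullet> f y = f x \<bullet> y"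
  shows "span {v. \<exists>l. f v = l *\<^sub>R v} = UNIV"
proof (rule ccontr)
  let ?E = "{v. \<exists>l. f v = l *\<^sub>R v}"
  define V where "V = {x. \<forall>y\<in>span ?E. orthogonal y x}"
  assume "span ?E \<noteq> UNIV"
  then obtain a where "a \<noteq> 0" "\<And>x. x \<in> span ?E \<Longrightarrow> orthogonal a x"
    using span_not_UNIV_orthogonal[of ?E] by (auto simp: orthogonal_def)
  then have ne: "V \<noteq> {0}"
    by (auto simp: V_def orthogonal_commute)
  have V: "subspace V"
    by (simp add: V_def subspace_orthogonal_to_vectors)
  have inv: "f x \<in> V" if "x \<in> V" for x
  proof -
    have "orthogonal (f x) y" if "y \<in> span ?E" for y
    proof (rule orthogonal_to_span[OF that])
      fix v assume v: "v \<in> ?E"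
      then obtain l where "f v = l *\<^sub>R v" by blast
      then show "orthogonal (f x) v"
        using \<open>x \<in> V\<close> span_base[OF v] sym[of x v]
        by (auto simp: V_def orthogonal_def inner_commute)
    qed
    then show ?thesis by (simp add: V_def orthogonal_commute)
  qed
  obtain v l where "v \<in> V" "v \<noteq> 0" "f v = l *\<^sub>R v"
    using symmetric_map_eigenvector_in_subspace[OF f sym V inv ne] .
  then have "orthogonal v v"
    using span_base[of v ?E] unfolding V_def by blast
  then show False using \<open>v \<noteq> 0\<close> by (simp add: orthogonal_def)
qed

lemma transpose_eq_iff_self_adjoint:
  fixes A :: "real ^ 'n ^ 'n"
  shows "transpose A = A \<longleftrightarrow> (\<forall>x y. x \<bullet> (A *v y) = (A *v x) \<bullet> y)"
proof
  assume "transpose A = A"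
  then show "\<forall>x y. x \<bullet> (A *v y) = (A *v x) \<bullet> y"
    by (metis dot_lmul_matrix transpose_matrix_vector)
next
  assume *: "\<forall>x y. x \<bullet> (A *v y) = (A *v x) \<bullet> y"
  have "(transpose A *v x) \<bullet> y = (A *v x) \<bullet> y" for x y
    using * by (metis dot_lmul_matrix transpose_matrix_vector)
  then show "transpose A = A"
    by (metis matrix_eq vector_eq_rdot)
qed

text \<open>Since (R + sqrt l)(R - sqrt l) v = 0, the vector u = R v - sqrt l v satisfies R u = -
  sqrt l u. Positivity of \<open>R\<close> excludes this for l > 0 unless u = 0; for l = 0, u
  \<bullet> u = v \<bullet> R (R v) = 0. All positive roots of \<open>A\<close> therefore agree on
  eigenvectors of \<open>A\<close>.\<close>

lemma pos_semidef_sqrt_eigenvector: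
  assumes A: "pos_semidef_matrix A" and R: "pos_semidef_matrix R" "R ** R = A"
    and v: "A *v v = l *\<^sub>R v"
  shows "R *v v = sqrt l *\<^sub>R v"
proof (cases "v = 0")
  case False
  have selfR: "x \<bullet> (R *v y) = (R *v x) \<bullet> y" for x y
    using R by (simp add: pos_semidef_matrix_def transpose_eq_iff_self_adjoint)
  have "0 \<le> v \<bullet> (A *v v)"
    using A by (simp add: pos_semidef_matrix_def)
  then have "0 \<le> l * (v \<bullet> v)" "0 < v \<bullet> v"
    using v False by simp_all
  then have l: "0 \<le> l"
    by (simp add: zero_le_mult_iff)
  have RR: "R *v (R *v v) = l *\<^sub>R v"
    using R v by (simp add: matrix_vector_mul_assoc)
  define u where "u = R *v v - sqrt l *\<^sub>R v"
  have Ru: "R *v u = - sqrt l *\<^sub>R u"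
    using l by (simp add: u_def matrix_vector_mult_diff_distrib matrix_vector_mult_scaleR RR algebra_simps)
  have pos: "0 \<le> u \<bullet> (R *v u)"
    using R by (simp add: pos_semidef_matrix_def)
  have "u = 0"
  proof (cases "l = 0")
    case True
    then have "u \<bullet> u = v \<bullet> (R *v (R *v v))"
      using selfR[of v "R *v v"] by (simp add: u_def)
    then show ?thesis using RR True by simp
  next
    case False
    then have "sqrt l * (u \<bullet> u) \<le> 0" "sqrt l > 0"
      using pos l unfolding Ru by auto
    then have "u \<bullet> u \<le> 0" by (simp add: mult_le_0_iff)
    then show ?thesis
      using inner_ge_zero[of u] inner_eq_zero_iff[of u] by linarith
  qed
  then show ?thesis by (simp add: u_def)
qed simp

text \<open>Functional calculus on a basis of eigenvectors that may fail to be orthogonal within one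
  eigenspace. The map \<open>h\<close> is still symmetric: it scales vectors with equal eigenvalues
  by the same factor, and vectors with different eigenvalues are orthogonal.\<close>

lemma self_adjoint_matrix_function:
  fixes A :: "real ^ 'n ^ 'n"
  assumes A: "transpose A = A"
  obtains Q B where "transpose Q = Q" "span B = UNIV"
    "\<And>v. v \<in> B \<Longrightarrow> \<exists>l. A *v v = l *\<^sub>R v \<and> Q *v v = g l *\<^sub>R v"
proof -
  let ?E = "{v. \<exists>l. A *v v = l *\<^sub>R v}"
  have selfA: "x \<bullet> (A *v y) = (A *v x) \<bullet> y" for x y
    using A by (simp add: transpose_eq_iff_self_adjoint)
  have spanE: "span ?E = UNIV"
    by (rule symmetric_map_eigenvectors_span) (auto intro: selfA)
  obtain B where B: "B \<subseteq> ?E" "independent B" "?E \<subseteq> span B"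
    by (rule maximal_independent_subset)
  have spanB: "span B = UNIV"
    using span_mono[OF B(3)] spanE by (auto simp: span_span)
  from B(1) have "\<forall>v\<in>B. \<exists>l. A *v v = l *\<^sub>R v" by blast
  then obtain lam where lam: "\<And>v. v \<in> B \<Longrightarrow> A *v v = lam v *\<^sub>R v" by metis
  obtain h where h: "linear h" "\<And>v. v \<in> B \<Longrightarrow> h v = g (lam v) *\<^sub>R v"
    using linear_independent_extend[OF B(2), of "\<lambda>v. g (lam v) *\<^sub>R v"] by blast
  have onB: "b \<bullet> h c = h b \<bullet> c" if "b \<in> B" "c \<in> B" for b c
  proof (cases "lam b = lam c")
    case False
    have "lam c * (b \<bullet> c) = lam b * (b \<bullet> c)"
      using selfA[of b c] that by (simp add: lam)
    then have "b \<bullet> c = 0" using False by simp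
    then show ?thesis using that by (simp add: h)
  qed (use that h in simp)
  have lin: "linear (\<lambda>x. x \<bullet> h y)" "linear (\<lambda>x. h x \<bullet> y)"
    "linear (\<lambda>x. y \<bullet> h x)" "linear (\<lambda>x. h y \<bullet> x)" for y
    using h(1) by (auto intro!: linearI simp: inner_left_distrib inner_right_distrib linear_add linear_scale)
  have half: "b \<bullet> h y = h b \<bullet> y" if "b \<in> B" for b y
    using linear_eq_on[of "\<lambda>y. b \<bullet> h y" "\<lambda>y. h b \<bullet> y" y B] lin onB that spanB by auto
  have "x \<bullet> h y = h x \<bullet> y" for x y
    using linear_eq_on[of "\<lambda>x. x \<bullet> h y" "\<lambda>x. h x \<bullet> y" x B] lin half spanB by auto
  moreover have "matrix h *v x = h x" for x
    using h(1) by (simp add: matrix_works linear_matrix_vector_mul_eq)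
  ultimately show thesis
    using that[of "matrix h" B] spanB h(2) lam by (auto simp: transpose_eq_iff_self_adjoint)
qed

lemma pos_semidef_matrix_square:
  assumes "transpose Q = Q"
  shows "pos_semidef_matrix (Q ** Q)"
proof -
  have "x \<bullet> (Q *v (Q *v x)) = (Q *v x) \<bullet> (Q *v x)" for x
    using assms by (simp add: transpose_eq_iff_self_adjoint)
  then show ?thesis
    using assms by (simp add: pos_semidef_matrix_def matrix_transpose_mul matrix_vector_mul_assoc[symmetric])
qed

lemma matrix_eq_on_span:
  fixes A B :: "real ^ 'n ^ 'm"
  assumes "span S = UNIV" "\<And>v. v \<in> S \<Longrightarrow> A *v v = B *v v"
  shows "A = B"
proof -
  have "A *v x = B *v x" for x
    using linear_eq_on[of "(*v) A" "(*v) B" x S] assms by auto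
  then show ?thesis by (simp add: matrix_eq)
qed

lemma matrix_sqrt:
  fixes A :: "real ^ 'n ^ 'n"
  assumes A: "pos_semidef_matrix A"
  shows "pos_semidef_matrix (matrix_sqrt A)" "matrix_sqrt A ** matrix_sqrt A = A"
proof -
  have symA: "transpose A = A"
    using A by (simp add: pos_semidef_matrix_def)
  (* A fourth root, so that the square root is a square and hence positive semidefinite. *)
  obtain Q B where Q: "transpose Q = Q" and B: "span B = UNIV"
    and QB: "\<And>v. v \<in> B \<Longrightarrow> \<exists>l. A *v v = l *\<^sub>R v \<and> Q *v v = sqrt (sqrt l) *\<^sub>R v"
    using self_adjoint_matrix_function[OF symA, of "\<lambda>l. sqrt (sqrt l)"] by metis
  have ex: "(Q ** Q) ** (Q ** Q) = A"
  proof (rule matrix_eq_on_span[OF B])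
    fix v assume "v \<in> B"
    then obtain l where l: "A *v v = l *\<^sub>R v" "Q *v v = sqrt (sqrt l) *\<^sub>R v"
      using QB by blast
    have "0 \<le> v \<bullet> (A *v v)"
      using A by (simp add: pos_semidef_matrix_def)
    then have "0 \<le> l * (v \<bullet> v)"
      using l(1) by simp
    \<comment> \<open>The spanning set may contain 0, whose eigenvalue is arbitrary and possibly
      negative.\<close>
    then have "v = 0 \<or> 0 \<le> l"
      using inner_gt_zero_iff[of v] by (metis not_less zero_le_mult_iff)
    then show "Q ** Q ** (Q ** Q) *v v = A *v v"
      by (auto simp: matrix_vector_mul_assoc[symmetric] l matrix_vector_mult_scaleR)
  qed
  have "\<exists>!R. pos_semidef_matrix R \<and> R ** R = A"
  proof (rule ex1I[of _ "Q ** Q"])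
    show "pos_semidef_matrix (Q ** Q) \<and> Q ** Q ** (Q ** Q) = A"
      using pos_semidef_matrix_square[OF Q] ex by simp
  next
    fix R assume R: "pos_semidef_matrix R \<and> R ** R = A"
    show "R = Q ** Q"
    proof (rule matrix_eq_on_span[OF B])
      fix v assume "v \<in> B"
      then obtain l where l: "A *v v = l *\<^sub>R v"
        using QB by blast
      then show "R *v v = Q ** Q *v v"
        using pos_semidef_sqrt_eigenvector[OF A _ _ l, of R] R
          pos_semidef_sqrt_eigenvector[OF A pos_semidef_matrix_square[OF Q] ex l] by simp
    qed
  qed
  from theI'[OF this] show "pos_semidef_matrix (matrix_sqrt A)" "matrix_sqrt A ** matrix_sqrt A = A"
    by (simp_all add: matrix_sqrt_def)
qed

section \<open>Inverses and normalisation by the inverse square root\<close>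

lemma matrix_inv_mult:
  fixes A :: "'a::semiring_1 ^ 'n ^ 'n"
  assumes "invertible A"
  shows "A ** matrix_inv A = mat 1" "matrix_inv A ** A = mat 1"
  using someI_ex[OF assms[unfolded invertible_def]] by (simp_all add: matrix_inv_def)

lemma pos_semidef_matrix_inv:
  fixes A :: "real ^ 'n ^ 'n"
  assumes A: "pos_semidef_matrix A" and inv: "invertible A"
  shows "pos_semidef_matrix (matrix_inv A)"
proof -
  have AI: "A *v (matrix_inv A *v x) = x" for x
    by (simp add: matrix_vector_mul_assoc matrix_inv_mult(1)[OF inv])
  have selfA: "x \<bullet> (A *v y) = (A *v x) \<bullet> y" for x y
    using A by (simp add: pos_semidef_matrix_def transpose_eq_iff_self_adjoint)
  have "x \<bullet> (matrix_inv A *v y) = (matrix_inv A *v x) \<bullet> y" for x y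
    using selfA[of "matrix_inv A *v x" "matrix_inv A *v y"] by (simp add: AI)
  moreover have "0 \<le> x \<bullet> (matrix_inv A *v x)" for x
    using A[unfolded pos_semidef_matrix_def] AI[of x] by (metis inner_commute)
  ultimately show ?thesis
    by (simp add: pos_semidef_matrix_def transpose_eq_iff_self_adjoint)
qed

text \<open>With R the root, R (R A) = A^-1 A = 1, so R A is a right inverse of R. For square
  matrices it is also a left inverse, which is the claim, without commuting R past A.\<close>

lemma sqrt_inv_conjugate:
  fixes A :: "real ^ 'n ^ 'n"
  assumes A: "pos_semidef_matrix A" and inv: "invertible A"
  shows "matrix_sqrt (matrix_inv A) ** A ** matrix_sqrt (matrix_inv A) = mat 1"
proof -
  let ?R = "matrix_sqrt (matrix_inv A)"
  have "?R ** (?R ** A) = mat 1"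
    by (simp add: matrix_mul_assoc matrix_sqrt[OF pos_semidef_matrix_inv[OF A inv]] matrix_inv_mult(2)[OF inv])
  then show ?thesis
    using matrix_left_right_inverse by blast
qed

section \<open>Integral operators with a positive semidefinite kernel\<close>

text \<open>The two preimages of a measurable set differ inside a null set, and completeness makes
  every part of that null set measurable.\<close>

lemma (in complete_measure) measurable_AE_eq:
  assumes f: "f \<in> measurable M N" and ae: "AE x in M. f x = g x"
    and g: "\<And>x. x \<in> space M \<Longrightarrow> g x \<in> space N"
  shows "g \<in> measurable M N"
proof (rule measurableI)
  fix A assume A: "A \<in> sets N"
  obtain Z where Z: "Z \<in> null_sets M" "{x \<in> space M. f x \<noteq> g x} \<subseteq> Z"
    using ae by (auto elim!: AE_E intro: null_setsI)
  have "g -` A \<inter> space M \<inter> Z \<in> sets M"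
    using Z(1) by (intro complete[of _ Z]) auto
  then have "(f -` A \<inter> space M - Z) \<union> (g -` A \<inter> space M \<inter> Z) \<in> sets M"
    using measurable_sets[OF f A] Z(1) by auto
  also have "(f -` A \<inter> space M - Z) \<union> (g -` A \<inter> space M \<inter> Z) = g -` A \<inter> space M"
    using Z(2) by force
  finally show "g -` A \<inter> space M \<in> sets M" .
qed (use g in auto)

lemma borel_measurable_matrix_vector_mult [measurable (raw)]:
  fixes A :: "'a \<Rightarrow> real ^ 'n ^ 'm"
  assumes "A \<in> borel_measurable M" "v \<in> borel_measurable M"
  shows "(\<lambda>x. A x *v v x) \<in> borel_measurable M"
proof (rule borel_measurable_continuous_Pair[OF assms])
  show "continuous_on UNIV (\<lambda>x :: (real ^ 'n ^ 'm) \<times> (real ^ 'n). fst x *v snd x)"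
    unfolding matrix_vector_mult_def by (intro continuous_intros)
qed

text \<open>Transfers integrals and almost sure statements from the square to a pair of sample
  points. Distinct indices matter: the law of \<open>(z i, z i)\<close> sits on the
  diagonal.\<close>

lemma (in prob_space) distr_PiM_pair:
  assumes "finite I" "i \<in> I" "j \<in> I" "i \<noteq> j"
  shows "distr (Pi\<^sub>M I (\<lambda>_. M)) (M \<Otimes>\<^sub>M M) (\<lambda>z. (z i, z j)) = M \<Otimes>\<^sub>M M"
proof (rule pair_measure_eqI[symmetric])
  interpret product_prob_space "\<lambda>_. M" I ..
  have [measurable]: "(\<lambda>z. (z i, z j)) \<in> measurable (Pi\<^sub>M I (\<lambda>_. M)) (M \<Otimes>\<^sub>M M)"
    using assms by measurable
  fix A B assume A: "A \<in> sets M" and B: "B \<in> sets M"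
  define X where "X = (\<lambda>k. if k = i then A else B)"
  have "(\<lambda>z. (z i, z j)) -` (A \<times> B) \<inter> space (Pi\<^sub>M I (\<lambda>_. M)) =
      prod_emb I (\<lambda>_. M) {i, j} (Pi\<^sub>E {i, j} X)"
    using assms A B by (auto simp: prod_emb_def space_PiM X_def PiE_iff)
  then have "emeasure (distr (Pi\<^sub>M I (\<lambda>_. M)) (M \<Otimes>\<^sub>M M) (\<lambda>z. (z i, z j))) (A \<times> B) =
      emeasure (Pi\<^sub>M I (\<lambda>_. M)) (prod_emb I (\<lambda>_. M) {i, j} (Pi\<^sub>E {i, j} X))"
    using A B by (simp add: emeasure_distr)
  also have "\<dots> = (\<Prod>k\<in>{i, j}. emeasure M (X k))"
    using assms A B by (intro emeasure_PiM_emb) (auto simp: X_def)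
  also have "\<dots> = emeasure M A * emeasure M B"
    using assms by (simp add: X_def)
  finally show "emeasure M A * emeasure M B =
      emeasure (distr (Pi\<^sub>M I (\<lambda>_. M)) (M \<Otimes>\<^sub>M M) (\<lambda>z. (z i, z j))) (A \<times> B)" by simp
qed (simp_all add: sigma_finite_measure_axioms)

(* Average the quadratic form over n independent sample points: the diagonal contributes
   only n of the n^2 terms and disappears in the limit. *)
lemma (in prob_space) integral_nonneg_of_sampled_sums_nonneg:
  fixes g :: "'a \<Rightarrow> real" and h :: "'a \<times> 'a \<Rightarrow> real"
  assumes g: "integrable M g" and h: "integrable (M \<Otimes>\<^sub>M M) h"
    and nonneg: "\<And>n::nat. AE z in Pi\<^sub>M {..<n} (\<lambda>_. M).
      0 \<le> (\<Sum>k<n. g (z k)) + (\<Sum>k<n. \<Sum>l\<in>{..<n} - {k}. h (z k, z l))"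
  shows "0 \<le> integral\<^sup>L (M \<Otimes>\<^sub>M M) h"
proof -
  define G where "G = integral\<^sup>L M g"
  define H where "H = integral\<^sup>L (M \<Otimes>\<^sub>M M) h"
  have bound: "0 \<le> real n * G + real n * (real (n - 1) * H)" for n
  proof -
    let ?Z = "Pi\<^sub>M {..<n} (\<lambda>_. M)"
    have gk: "has_bochner_integral ?Z (\<lambda>z. g (z k)) G" if "k \<in> {..<n}" for k
    proof -
      have d: "distr ?Z M (\<lambda>z. z k) = M"
        using that by (intro distr_PiM_component prob_space_axioms) auto
      have "(\<lambda>z. z k) \<in> measurable ?Z M"
        using that by (intro measurable_component_singleton) simp
      then show ?thesis
        using integrable_distr_eq[of "\<lambda>z. z k" ?Z M g] integral_distr[of "\<lambda>z. z k" ?Z M g] g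
        by (simp add: d G_def has_bochner_integral_iff)
    qed
    have hkl: "has_bochner_integral ?Z (\<lambda>z. h (z k, z l)) H"
      if "k \<in> {..<n}" "l \<in> {..<n} - {k}" for k l
    proof -
      have d: "distr ?Z (M \<Otimes>\<^sub>M M) (\<lambda>z. (z k, z l)) = M \<Otimes>\<^sub>M M"
        using that by (intro distr_PiM_pair) auto
      have "(\<lambda>z. (z k, z l)) \<in> measurable ?Z (M \<Otimes>\<^sub>M M)"
        using that by (intro measurable_Pair measurable_component_singleton) auto
      then show ?thesis
        using integrable_distr_eq[of "\<lambda>z. (z k, z l)" ?Z "M \<Otimes>\<^sub>M M" h]
          integral_distr[of "\<lambda>z. (z k, z l)" ?Z "M \<Otimes>\<^sub>M M" h] h
        by (simp add: d H_def has_bochner_integral_iff)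
    qed
    have "has_bochner_integral ?Z
        (\<lambda>z. (\<Sum>k<n. g (z k)) + (\<Sum>k<n. \<Sum>l\<in>{..<n} - {k}. h (z k, z l)))
        ((\<Sum>k<n. G) + (\<Sum>k<n. \<Sum>l\<in>{..<n} - {k}. H))"
      by (intro has_bochner_integral_add has_bochner_integral_sum gk hkl)
    then have "0 \<le> (\<Sum>k<n. G) + (\<Sum>k<n. \<Sum>l\<in>{..<n} - {k}. H)"
      using integral_nonneg_AE[OF nonneg[of n]] has_bochner_integral_integral_eq by fastforce
    also have "\<dots> = real n * G + real n * (real (n - 1) * H)"
      by (cases n) simp_all
    finally show ?thesis .
  qed
  show ?thesis
  proof (rule ccontr)
    assume "\<not> ?thesis"
    then have neg: "H < 0" by (simp add: H_def)
    \<comment> \<open>With n = m + 1 the bound, divided by n, reads 0 \<le> G + m H, which fails for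
      m beyond G / (- H).\<close>
    obtain m :: nat where m: "G / (- H) < real m"
      using reals_Archimedean2 by blast
    have "0 \<le> real (Suc m) * (G + real m * H)"
      using bound[of "Suc m"] by (simp add: algebra_simps)
    then have "0 \<le> G + real m * H"
      by (simp add: zero_le_mult_iff)
    with m neg show False by (simp add: field_simps)
  qed
qed

text \<open>The norm form of square integrability suits inner product estimates;
  \<open>square_integrable_vec_components\<close> recovers it from the componentwise form of the
  equilibrium definition.\<close>

definition square_integrable_vec :: "'a measure \<Rightarrow> ('a \<Rightarrow> 'b::euclidean_space) \<Rightarrow> bool" where
  "square_integrable_vec M f \<longleftrightarrow> f \<in> borel_measurable M \<and> integrable M (\<lambda>x. (norm (f x))\<^sup>2)"

lemma square_integrable_vec_measurable:
  "square_integrable_vec M f \<Longrightarrow> f \<in> borel_measurable M"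
  by (simp add: square_integrable_vec_def)

lemma integrable_inner:
  assumes f: "square_integrable_vec M f" and g: "square_integrable_vec M g"
  shows "integrable M (\<lambda>x. f x \<bullet> g x)"
proof (rule Bochner_Integration.integrable_bound)
  show "integrable M (\<lambda>x. (norm (f x))\<^sup>2 + (norm (g x))\<^sup>2)"
    using assms by (simp add: square_integrable_vec_def)
  have "norm (u \<bullet> v) \<le> norm ((norm u)\<^sup>2 + (norm v)\<^sup>2)" for u v :: 'b
    using Cauchy_Schwarz_ineq2[of u v] sum_squares_bound[of "norm u" "norm v"]
      mult_nonneg_nonneg[OF norm_ge_zero[of u] norm_ge_zero[of v]] by simp
  then show "AE x in M. norm (f x \<bullet> g x) \<le> norm ((norm (f x))\<^sup>2 + (norm (g x))\<^sup>2)"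
    by simp
  show "(\<lambda>x. f x \<bullet> g x) \<in> borel_measurable M"
    using assms by (auto simp: square_integrable_vec_def)
qed

lemma square_integrable_vec_diff:
  assumes f: "square_integrable_vec M f" and g: "square_integrable_vec M g"
  shows "square_integrable_vec M (\<lambda>x. f x - g x)"
proof -
  have "integrable M (\<lambda>x. (norm (f x))\<^sup>2 - 2 * (f x \<bullet> g x) + (norm (g x))\<^sup>2)"
    using assms integrable_inner[OF f g] by (simp add: square_integrable_vec_def)
  then show ?thesis
    using assms by (auto simp: square_integrable_vec_def power2_norm_eq_inner inner_diff_left
        inner_diff_right inner_commute algebra_simps)
qed

lemma square_integrable_vec_scaleR:
  "square_integrable_vec M f \<Longrightarrow> square_integrable_vec M (\<lambda>x. c *\<^sub>R f x)"
  by (auto simp: square_integrable_vec_def power_mult_distrib)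

lemma (in finite_measure) integrable_norm_of_square:
  assumes "square_integrable_vec M f"
  shows "integrable M (\<lambda>x. norm (f x))"
proof (rule Bochner_Integration.integrable_bound)
  show "integrable M (\<lambda>x. 1 + (norm (f x))\<^sup>2)"
    using assms by (simp add: square_integrable_vec_def)
  have "t \<le> 1 + t\<^sup>2" for t :: real
    using sum_squares_bound[of 1 t] zero_le_power2[of t] unfolding power_one mult_1_right
    by (cases "0 \<le> t") linarith+
  then show "AE x in M. norm (norm (f x)) \<le> norm (1 + (norm (f x))\<^sup>2)"
    by simp
  show "(\<lambda>x. norm (f x)) \<in> borel_measurable M"
    using assms by (auto simp: square_integrable_vec_def)
qed

lemma (in prob_space) square_integral_le_integral_square:
  fixes f :: "'a \<Rightarrow> real"
  assumes "integrable M f" "integrable M (\<lambda>x. (f x)\<^sup>2)"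
  shows "(\<integral>x. f x \<partial>M)\<^sup>2 \<le> (\<integral>x. (f x)\<^sup>2 \<partial>M)"
  using variance_eq[OF assms] variance_positive[of f] by simp

(* P is the kernel itself; p is a version of P that is measurable on the product space, so
   that Fubini applies. They agree almost everywhere, whereas positivity is only known for P. *)
locale correlation_kernel = prob_space U + complete_measure U for U :: "'a measure" +
  fixes P p :: "'a \<Rightarrow> 'a \<Rightarrow> real ^ 'd ^ 'd"
  assumes diagonal: "x \<in> space U \<Longrightarrow> P x x = mat 1"
    and transpose_kernel: "x \<in> space U \<Longrightarrow> y \<in> space U \<Longrightarrow> P y x = transpose (P x y)"
    and pos_semidef_kernel:
      "(\<And>k. k < n \<Longrightarrow> z k \<in> space U) \<Longrightarrow>
        0 \<le> (\<Sum>k<n::nat. \<Sum>l<n. v k \<bullet> (P (z k) (z l) *v v l))"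
    and section_measurable: "x \<in> space U \<Longrightarrow> P x \<in> borel_measurable U"
    and version_measurable [measurable]: "(\<lambda>(x, y). p x y) \<in> borel_measurable (U \<Otimes>\<^sub>M U)"
    and version_eq: "AE (x, y) in U \<Otimes>\<^sub>M U. p x y = P x y"
begin

sublocale pair: pair_sigma_finite U U ..

abbreviation L2 :: "('a \<Rightarrow> real ^ 'd) \<Rightarrow> bool" where
  "L2 \<equiv> square_integrable_vec U"

text \<open>Built from \<open>P\<close> rather than \<open>p\<close>, so that it matches the
  equilibrium equation and the pointwise bounds hold at every point of the space.\<close>

definition T :: "('a \<Rightarrow> real ^ 'd) \<Rightarrow> 'a \<Rightarrow> real ^ 'd" where
  "T f x = (\<integral>y. P x y *v f y \<partial>U)"

definition B :: "('a \<Rightarrow> real ^ 'd) \<Rightarrow> ('a \<Rightarrow> real ^ 'd) \<Rightarrow> real" where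
  "B f g = (\<integral>x. f x \<bullet> T g x \<partial>U)"

section \<open>Pointwise consequences of symmetry and positivity\<close>

lemma inner_kernel_commute:
  "x \<in> space U \<Longrightarrow> y \<in> space U \<Longrightarrow> v \<bullet> (P y x *v u) = u \<bullet> (P x y *v v)"
  by (metis transpose_kernel dot_lmul_matrix transpose_matrix_vector inner_commute)

text \<open>Positivity at the two points x, y with vectors u, -v; the identity blocks on the
  diagonal give the squared norms on the right.\<close>

lemma inner_kernel_le:
  assumes x: "x \<in> space U" and y: "y \<in> space U"
  shows "2 * (u \<bullet> (P x y *v v)) \<le> u \<bullet> u + v \<bullet> v"
proof -
  define z where "z k = (if k = 0 then x else y)" for k :: nat
  define w where "w k = (if k = 0 then u else - v)" for k :: nat
  have "0 \<le> (\<Sum>k<2. \<Sum>l<2. w k \<bullet> (P (z k) (z l) *v w l))"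
    by (rule pos_semidef_kernel) (simp add: z_def x y)
  moreover have "P x y *v (- v) = - (P x y *v v)"
    using matrix_vector_mult_diff_distrib[of "P x y" 0 v] by simp
  ultimately show ?thesis
    using x y inner_kernel_commute[OF x y, of v u]
    by (simp add: numeral_2_eq_2 z_def w_def diagonal)
qed

lemma norm_kernel_le:
  assumes x: "x \<in> space U" and y: "y \<in> space U"
  shows "norm (P x y *v v) \<le> norm v"
proof -
  \<comment> \<open>The choice u = P x y v turns the bilinear bound into an operator norm
    bound.\<close>
  have "2 * ((P x y *v v) \<bullet> (P x y *v v)) \<le> (P x y *v v) \<bullet> (P x y *v v) + v \<bullet> v"
    by (rule inner_kernel_le[OF x y])
  then show ?thesis
    by (simp add: norm_le)
qed

lemma section_integrable:
  assumes f: "L2 f" and x: "x \<in> space U"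
  shows "integrable U (\<lambda>y. P x y *v f y)"
proof (rule Bochner_Integration.integrable_bound)
  show "integrable U (\<lambda>y. norm (f y))"
    using f by (rule integrable_norm_of_square)
  show "(\<lambda>y. P x y *v f y) \<in> borel_measurable U"
    using section_measurable[OF x] square_integrable_vec_measurable[OF f] by measurable
  show "AE y in U. norm (P x y *v f y) \<le> norm (norm (f y))"
    using norm_kernel_le[OF x] by (intro AE_I2) simp
qed

lemma T_diff:
  assumes "L2 f" "L2 g" "x \<in> space U"
  shows "T (\<lambda>y. f y - g y) x = T f x - T g x"
  using section_integrable[of f x] section_integrable[of g x] assms
  by (simp add: T_def matrix_vector_mult_diff_distrib)

lemma T_scaleR: "T (\<lambda>y. c *\<^sub>R f y) x = c *\<^sub>R T f x"
  by (simp add: T_def matrix_vector_mult_scaleR)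

section \<open>The operator on square-integrable functions\<close>

lemma version_section_measurable [measurable]:
  "x \<in> space U \<Longrightarrow> p x \<in> borel_measurable U"
  using measurable_Pair2[OF version_measurable] by simp

lemma version_eq_iterated: "AE x in U. AE y in U. p x y = P x y"
  using pair.AE_pair[OF version_eq] by simp

lemma version_eq_swap: "AE (x, y) in U \<Otimes>\<^sub>M U. p y x = P y x"
proof -
  have "AE z in distr (U \<Otimes>\<^sub>M U) (U \<Otimes>\<^sub>M U) (\<lambda>(x, y). (y, x)). p (fst z) (snd z) = P (fst z) (snd z)"
    using version_eq by (subst pair.distr_pair_swap[symmetric]) (simp add: split_beta)
  from AE_distrD[OF _ this] show ?thesis
    by (simp add: split_beta)
qed

lemma T_eq_version:
  assumes f: "L2 f"
  shows "AE x in U. T f x = (\<integral>y. p x y *v f y \<partial>U)"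
  using version_eq_iterated
proof (rule AE_mp, intro AE_I2 impI)
  fix x assume x: "x \<in> space U" and ae: "AE y in U. p x y = P x y"
  note [measurable] = section_measurable[OF x] version_section_measurable[OF x]
    square_integrable_vec_measurable[OF f]
  show "T f x = (\<integral>y. p x y *v f y \<partial>U)"
    unfolding T_def using ae by (intro integral_cong_AE) auto
qed

text \<open>Fubini measurability is available for the integral of \<open>p\<close>;
  \<open>T f\<close> equals it almost everywhere, and completeness closes the gap.\<close>

lemma T_measurable:
  assumes f: "L2 f"
  shows "T f \<in> borel_measurable U"
proof (rule measurable_AE_eq)
  note [measurable] = square_integrable_vec_measurable[OF f]
  show "(\<lambda>x. \<integral>y. p x y *v f y \<partial>U) \<in> borel_measurable U"
    by measurable
  show "AE x in U. (\<integral>y. p x y *v f y \<partial>U) = T f x"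
    using T_eq_version[OF f] by (auto simp: eq_commute)
qed simp

lemma norm_T_le:
  assumes f: "L2 f" and x: "x \<in> space U"
  shows "norm (T f x) \<le> (\<integral>y. norm (f y) \<partial>U)"
proof -
  have "norm (T f x) \<le> (\<integral>y. norm (P x y *v f y) \<partial>U)"
    unfolding T_def by (rule integral_norm_bound)
  also have "\<dots> \<le> (\<integral>y. norm (f y) \<partial>U)"
    using section_integrable[OF f x] integrable_norm_of_square[OF f] norm_kernel_le[OF x]
    by (intro integral_mono) auto
  finally show ?thesis .
qed

lemma T_L2:
  assumes f: "L2 f"
  shows "L2 (T f)"
  unfolding square_integrable_vec_def
proof
  show [measurable]: "T f \<in> borel_measurable U"
    using f by (rule T_measurable)
  have "norm ((norm (T f x))\<^sup>2) \<le> (\<integral>y. norm (f y) \<partial>U)\<^sup>2" if "x \<in> space U" for x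
    using norm_T_le[OF f that] by (simp add: power_mono)
  then show "integrable U (\<lambda>x. (norm (T f x))\<^sup>2)"
    by (intro integrable_const_bound[of _ "(\<integral>y. norm (f y) \<partial>U)\<^sup>2"] AE_I2) measurable
qed

text \<open>The integrand is dominated by the product of the two norms. The contraction bound
  belongs to \<open>P\<close>, so it reaches \<open>p\<close> only almost everywhere.\<close>

lemma form_integrable:
  assumes f: "L2 f" and g: "L2 g"
  shows "integrable (U \<Otimes>\<^sub>M U) (\<lambda>(x, y). f x \<bullet> (p x y *v g y))"
proof (rule Bochner_Integration.integrable_bound)
  note [measurable] = square_integrable_vec_measurable[OF f] square_integrable_vec_measurable[OF g]
  show "integrable (U \<Otimes>\<^sub>M U) (\<lambda>(x, y). norm (f x) * norm (g y))"
    using integrable_norm_of_square[OF f] integrable_norm_of_square[OF g]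
    by (intro pair.Fubini_integrable) (auto simp: abs_mult)
  show "(\<lambda>(x, y). f x \<bullet> (p x y *v g y)) \<in> borel_measurable (U \<Otimes>\<^sub>M U)"
    by measurable
  show "AE z in U \<Otimes>\<^sub>M U. norm (case z of (x, y) \<Rightarrow> f x \<bullet> (p x y *v g y))
      \<le> norm (case z of (x, y) \<Rightarrow> norm (f x) * norm (g y))"
    using version_eq
  proof (rule AE_mp, intro AE_I2 impI)
    fix z assume "z \<in> space (U \<Otimes>\<^sub>M U)" and eq: "case z of (x, y) \<Rightarrow> p x y = P x y"
    then obtain x y where z: "z = (x, y)" and x: "x \<in> space U" and y: "y \<in> space U"
      by (auto simp: space_pair_measure)
    have "\<bar>f x \<bullet> (P x y *v g y)\<bar> \<le> norm (f x) * norm (P x y *v g y)"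
      by (rule Cauchy_Schwarz_ineq2)
    also have "\<dots> \<le> norm (f x) * norm (g y)"
      using norm_kernel_le[OF x y] by (intro mult_left_mono) auto
    finally show "norm (case z of (x, y) \<Rightarrow> f x \<bullet> (p x y *v g y))
        \<le> norm (case z of (x, y) \<Rightarrow> norm (f x) * norm (g y))"
      using eq by (simp add: z)
  qed
qed

lemma B_eq_integral_pair:
  assumes f: "L2 f" and g: "L2 g"
  shows "B f g = (\<integral>(x, y). f x \<bullet> (p x y *v g y) \<partial>(U \<Otimes>\<^sub>M U))"
proof -
  note [measurable] = square_integrable_vec_measurable[OF f] square_integrable_vec_measurable[OF g]
    T_measurable[OF g]
  have "AE x in U. f x \<bullet> T g x = (\<integral>y. f x \<bullet> (p x y *v g y) \<partial>U)"
    using version_eq_iterated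
  proof (rule AE_mp, intro AE_I2 impI)
    fix x assume x: "x \<in> space U" and ae: "AE y in U. p x y = P x y"
    note [measurable] = section_measurable[OF x] version_section_measurable[OF x]
    have "f x \<bullet> T g x = (\<integral>y. f x \<bullet> (P x y *v g y) \<partial>U)"
      using section_integrable[OF g x] by (simp add: T_def)
    also have "\<dots> = (\<integral>y. f x \<bullet> (p x y *v g y) \<partial>U)"
      using ae by (intro integral_cong_AE) auto
    finally show "f x \<bullet> T g x = (\<integral>y. f x \<bullet> (p x y *v g y) \<partial>U)" .
  qed
  then have "B f g = (\<integral>x. \<integral>y. f x \<bullet> (p x y *v g y) \<partial>U \<partial>U)"
    unfolding B_def by (intro integral_cong_AE) auto
  also have "\<dots> = (\<integral>(x, y). f x \<bullet> (p x y *v g y) \<partial>(U \<Otimes>\<^sub>M U))"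
    using form_integrable[OF f g] by (rule pair.integral_fst)
  finally show ?thesis .
qed

text \<open>Exchange the variables in the double integral and use P(y,x) = P(x,y)^T; this needs the
  version to agree with the kernel at (x,y) and at (y,x).\<close>

lemma B_commute:
  assumes f: "L2 f" and g: "L2 g"
  shows "B f g = B g f"
proof -
  note [measurable] = square_integrable_vec_measurable[OF f] square_integrable_vec_measurable[OF g]
  have "B f g = (\<integral>(x, y). f x \<bullet> (p x y *v g y) \<partial>(U \<Otimes>\<^sub>M U))"
    using f g by (rule B_eq_integral_pair)
  also have "\<dots> = (\<integral>(x, y). g y \<bullet> (p y x *v f x) \<partial>(U \<Otimes>\<^sub>M U))"
  proof (rule integral_cong_AE)
    show "AE z in U \<Otimes>\<^sub>M U. (case z of (x, y) \<Rightarrow> f x \<bullet> (p x y *v g y)) =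
        (case z of (x, y) \<Rightarrow> g y \<bullet> (p y x *v f x))"
      using version_eq version_eq_swap
      using AE_space
      by eventually_elim (auto simp: space_pair_measure inner_kernel_commute)
  qed measurable
  also have "\<dots> = (\<integral>(x, y). g x \<bullet> (p x y *v f y) \<partial>(U \<Otimes>\<^sub>M U))"
    using pair.integral_product_swap[of "\<lambda>(x, y). g x \<bullet> (p x y *v f y)"] form_integrable[OF g f]
    by (auto intro: borel_measurable_integrable)
  also have "\<dots> = B g f"
    using g f by (rule B_eq_integral_pair[symmetric])
  finally show ?thesis .
qed

text \<open>Agreement of \<open>p\<close> with \<open>P\<close> at almost all pairs says nothing
  reliable about the diagonal. Hence the diagonal terms of the sampled form are evaluated through
  P(x,x) = 1 as squared norms of \<open>f\<close>, and \<open>p\<close> is used only for distinct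
  indices.\<close>

lemma B_nonneg:
  assumes f: "L2 f"
  shows "0 \<le> B f f"
  unfolding B_eq_integral_pair[OF f f]
proof (rule integral_nonneg_of_sampled_sums_nonneg)
  let ?h = "\<lambda>(x, y). f x \<bullet> (p x y *v f y)"
  show "integrable U (\<lambda>x. (norm (f x))\<^sup>2)"
    using f by (simp add: square_integrable_vec_def)
  show "integrable (U \<Otimes>\<^sub>M U) ?h"
    using f f by (rule form_integrable)
  fix n :: nat
  let ?Z = "Pi\<^sub>M {..<n} (\<lambda>_. U)"
  have "AE z in ?Z. \<forall>l\<in>{..<n} - {k}. p (z k) (z l) = P (z k) (z l)" if "k \<in> {..<n}" for k
  proof (intro AE_finite_allI)
    fix l assume l: "l \<in> {..<n} - {k}"
    have d: "distr ?Z (U \<Otimes>\<^sub>M U) (\<lambda>z. (z k, z l)) = U \<Otimes>\<^sub>M U"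
      using that l by (intro distr_PiM_pair) auto
    have "(\<lambda>z. (z k, z l)) \<in> measurable ?Z (U \<Otimes>\<^sub>M U)"
      using that l by (intro measurable_Pair measurable_component_singleton) auto
    from AE_distrD[OF this, of "\<lambda>(x, y). p x y = P x y"]
    show "AE z in ?Z. p (z k) (z l) = P (z k) (z l)"
      using version_eq unfolding d by simp
  qed simp
  then have "AE z in ?Z. \<forall>k\<in>{..<n}. \<forall>l\<in>{..<n} - {k}. p (z k) (z l) = P (z k) (z l)"
    by (intro AE_finite_allI[where S = "{..<n}"]) simp_all
  then show "AE z in ?Z. 0 \<le> (\<Sum>k<n. (norm (f (z k)))\<^sup>2) +
      (\<Sum>k<n. \<Sum>l\<in>{..<n} - {k}. ?h (z k, z l))"
  proof (rule AE_mp, intro AE_I2 impI)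
    fix z assume z: "z \<in> space ?Z"
      and eq: "\<forall>k\<in>{..<n}. \<forall>l\<in>{..<n} - {k}. p (z k) (z l) = P (z k) (z l)"
    have zU: "z k \<in> space U" if "k < n" for k
      using z that by (auto simp: space_PiM)
    have "0 \<le> (\<Sum>k<n. \<Sum>l<n. f (z k) \<bullet> (P (z k) (z l) *v f (z l)))"
      using zU by (rule pos_semidef_kernel)
    also have "\<dots> = (\<Sum>k<n. (norm (f (z k)))\<^sup>2 + (\<Sum>l\<in>{..<n} - {k}. ?h (z k, z l)))"
    proof (rule sum.cong[OF refl])
      fix k assume k: "k \<in> {..<n}"
      then have "(\<Sum>l<n. f (z k) \<bullet> (P (z k) (z l) *v f (z l))) =
          f (z k) \<bullet> (P (z k) (z k) *v f (z k)) +
          (\<Sum>l\<in>{..<n} - {k}. f (z k) \<bullet> (P (z k) (z l) *v f (z l)))"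
        by (intro sum.remove) auto
      then show "(\<Sum>l<n. f (z k) \<bullet> (P (z k) (z l) *v f (z l))) =
          (norm (f (z k)))\<^sup>2 + (\<Sum>l\<in>{..<n} - {k}. ?h (z k, z l))"
        using k eq zU by (simp add: diagonal power2_norm_eq_inner)
    qed
    finally show "0 \<le> (\<Sum>k<n. (norm (f (z k)))\<^sup>2) + (\<Sum>k<n. \<Sum>l\<in>{..<n} - {k}. ?h (z k, z l))"
      by (simp add: sum.distrib)
  qed
qed

text \<open>The contraction bound yields \<open>B f f\<close> \<le> (integral of the norm of
  \<open>f\<close>)^2, and on a probability space this is at most the integral of the
  square.\<close>

lemma B_le:
  assumes f: "L2 f"
  shows "B f f \<le> (\<integral>x. (norm (f x))\<^sup>2 \<partial>U)"
proof -
  note n = integrable_norm_of_square[OF f]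
  have le: "f x \<bullet> T f x \<le> norm (f x) * (\<integral>y. norm (f y) \<partial>U)" if "x \<in> space U" for x
    using norm_cauchy_schwarz[of "f x" "T f x"] mult_left_mono[OF norm_T_le[OF f that] norm_ge_zero[of "f x"]]
    by linarith
  have "B f f \<le> (\<integral>x. norm (f x) * (\<integral>y. norm (f y) \<partial>U) \<partial>U)"
    unfolding B_def using integrable_inner[OF f T_L2[OF f]] n le by (intro integral_mono) auto
  also have "\<dots> = (\<integral>x. norm (f x) \<partial>U)\<^sup>2"
    by (simp add: power2_eq_square)
  also have "\<dots> \<le> (\<integral>x. (norm (f x))\<^sup>2 \<partial>U)"
    using n f by (intro square_integral_le_integral_square) (auto simp: square_integrable_vec_def)
  finally show ?thesis .
qed

(* Positivity of the form at f - T f gives T^2 \<le> T. *)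
lemma integral_norm_T_le:
  assumes f: "L2 f"
  shows "(\<integral>x. (norm (T f x))\<^sup>2 \<partial>U) \<le> B f f"
proof -
  note Tf = T_L2[OF f] and TTf = T_L2[OF T_L2[OF f]]
  have "B (\<lambda>x. f x - T f x) (\<lambda>x. f x - T f x) = (\<integral>x. (f x - T f x) \<bullet> (T f x - T (T f) x) \<partial>U)"
    unfolding B_def by (intro Bochner_Integration.integral_cong refl) (simp add: T_diff[OF f Tf])
  also have "\<dots> = B f f - B f (T f) - B (T f) f + B (T f) (T f)"
    using integrable_inner[OF f Tf] integrable_inner[OF f TTf] integrable_inner[OF Tf Tf]
      integrable_inner[OF Tf TTf]
    by (simp add: B_def inner_diff_left inner_diff_right)
  also have "B f (T f) = B (T f) f"
    using f Tf by (rule B_commute)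
  also have "B (T f) f = (\<integral>x. (norm (T f x))\<^sup>2 \<partial>U)"
    by (simp add: B_def power2_norm_eq_inner)
  \<comment> \<open>Positivity now reads 2 ||T f||^2 \<le> <f, T f> + <T f, T (T f)>, and
    \<open>B_le\<close> absorbs the last term into one copy of ||T f||^2.\<close>
  finally show ?thesis
    using B_nonneg[OF square_integrable_vec_diff[OF f Tf]] B_le[OF Tf] by simp
qed

text \<open>Pairing with \<open>d\<close> gives ||d||^2 = a <d, T d>. For a < 0 the right side is
  nonpositive because T \<ge> 0; for 0 \<le> a < 1 the bound T \<le> 1 gives (1 - a) <d, T d> \<le>
  0.\<close>

lemma homogeneous_solution_zero:
  assumes "a < 1" and d: "L2 d" and d_eq: "AE x in U. d x = a *\<^sub>R T d x"
  shows "AE x in U. d x = 0"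
proof -
  have int: "integrable U (\<lambda>x. (norm (d x))\<^sup>2)"
    using d by (simp add: square_integrable_vec_def)
  note [measurable] = square_integrable_vec_measurable[OF d] T_measurable[OF d]
  have "(\<integral>x. (norm (d x))\<^sup>2 \<partial>U) = (\<integral>x. a * (d x \<bullet> T d x) \<partial>U)"
  proof (rule integral_cong_AE)
    show "AE x in U. (norm (d x))\<^sup>2 = a * (d x \<bullet> T d x)"
      using d_eq by eventually_elim (metis inner_scaleR_right power2_norm_eq_inner)
  qed measurable
  then have eq: "(\<integral>x. (norm (d x))\<^sup>2 \<partial>U) = a * B d d"
    by (simp add: B_def)
  have "a * B d d \<le> 0 \<or> B d d = 0"
  proof (cases "0 \<le> a")
    case True
    have "(1 - a) * B d d \<le> 0"
      using B_le[OF d] eq by (simp add: algebra_simps)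
    then have "B d d \<le> 0"
      using assms(1) by (simp add: mult_le_0_iff)
    then show ?thesis
      using True by (simp add: mult_nonneg_nonpos)
  qed (use B_nonneg[OF d] in \<open>auto simp: mult_nonpos_nonneg\<close>)
  then have "(\<integral>x. (norm (d x))\<^sup>2 \<partial>U) = 0"
    using eq Bochner_Integration.integral_nonneg[of U "\<lambda>x. (norm (d x))\<^sup>2"] by auto
  then show ?thesis
    using integral_nonneg_eq_0_iff_AE[OF int] by simp
qed

section \<open>Norm identities and bounds for f = a T f + q\<close>

context
  fixes a :: real and f q :: "'a \<Rightarrow> real ^ 'd"
  assumes f: "L2 f" and f_eq: "AE x in U. f x = a *\<^sub>R T f x + q x"
begin

text \<open>Square integrability comes from f - a T f, which equals \<open>q\<close> almost
  everywhere.\<close>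

lemma q_L2: "L2 q"
proof -
  have diff: "L2 (\<lambda>x. f x - a *\<^sub>R T f x)"
    using f T_L2[OF f] by (intro square_integrable_vec_diff square_integrable_vec_scaleR)
  have ae: "AE x in U. f x - a *\<^sub>R T f x = q x"
    using f_eq by eventually_elim simp
  have m [measurable]: "q \<in> borel_measurable U"
    using square_integrable_vec_measurable[OF diff] ae by (rule measurable_AE_eq) simp
  have "integrable U (\<lambda>x. (norm (f x - a *\<^sub>R T f x))\<^sup>2) \<longleftrightarrow> integrable U (\<lambda>x. (norm (q x))\<^sup>2)"
    using ae square_integrable_vec_measurable[OF diff] by (intro integrable_cong_AE) auto
  then show ?thesis
    using diff m by (simp add: square_integrable_vec_def)
qed

lemma integral_norm_q:
  "(\<integral>x. (norm (q x))\<^sup>2 \<partial>U) =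
    (\<integral>x. (norm (f x))\<^sup>2 \<partial>U) - 2 * a * B f f + a\<^sup>2 * (\<integral>x. (norm (T f x))\<^sup>2 \<partial>U)"
proof -
  note Tf = T_L2[OF f]
  note [measurable] = square_integrable_vec_measurable[OF f] square_integrable_vec_measurable[OF Tf]
    square_integrable_vec_measurable[OF q_L2]
  have "(\<integral>x. (norm (q x))\<^sup>2 \<partial>U) =
      (\<integral>x. (norm (f x))\<^sup>2 - 2 * a * (f x \<bullet> T f x) + a\<^sup>2 * (norm (T f x))\<^sup>2 \<partial>U)"
  proof (rule integral_cong_AE)
    show "AE x in U. (norm (q x))\<^sup>2 =
        (norm (f x))\<^sup>2 - 2 * a * (f x \<bullet> T f x) + a\<^sup>2 * (norm (T f x))\<^sup>2"
      using f_eq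
    proof eventually_elim
      case (elim x)
      then have q: "q x = f x - a *\<^sub>R T f x" by simp
      then show ?case
        unfolding power2_norm_eq_inner q
        by (simp add: inner_diff_left inner_diff_right inner_commute power2_eq_square)
    qed
  qed measurable
  also have "\<dots> = (\<integral>x. (norm (f x))\<^sup>2 \<partial>U) - 2 * a * B f f + a\<^sup>2 * (\<integral>x. (norm (T f x))\<^sup>2 \<partial>U)"
    using integrable_inner[OF f Tf] f Tf by (simp add: B_def square_integrable_vec_def)
  finally show ?thesis .
qed

text \<open>In the expansion of ||q||^2, T^2 \<le> T bounds the quadratic term by a^2 <f, T f>, and
  a^2 \<le> 2 a lets the cross term cancel it.\<close>

lemma integral_norm_q_le_of_nonneg:
  assumes "0 \<le> a" "a < 1"
  shows "(\<integral>x. (norm (q x))\<^sup>2 \<partial>U) \<le> (\<integral>x. (norm (f x))\<^sup>2 \<partial>U)"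
proof -
  have "a\<^sup>2 * (\<integral>x. (norm (T f x))\<^sup>2 \<partial>U) \<le> a\<^sup>2 * B f f"
    using integral_norm_T_le[OF f] by (rule mult_left_mono) simp
  also have "\<dots> \<le> 2 * a * B f f"
    using assms B_nonneg[OF f] by (intro mult_right_mono) (simp_all add: power2_eq_square mult_right_mono)
  finally show ?thesis
    by (simp add: integral_norm_q)
qed

text \<open>Now both correction terms have nonnegative coefficients, so each form is replaced by
  ||f||^2; the coefficients add up to 1 - 2 a + a^2 = (1 - a)^2.\<close>

lemma integral_norm_q_le_of_nonpos:
  assumes "a \<le> 0"
  shows "(\<integral>x. (norm (q x))\<^sup>2 \<partial>U) \<le> (1 - a)\<^sup>2 * (\<integral>x. (norm (f x))\<^sup>2 \<partial>U)"
proof -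
  let ?N = "\<integral>x. (norm (f x))\<^sup>2 \<partial>U"
  have "a\<^sup>2 * (\<integral>x. (norm (T f x))\<^sup>2 \<partial>U) \<le> a\<^sup>2 * ?N"
    using integral_norm_T_le[OF f] B_le[OF f] by (intro mult_left_mono) auto
  moreover have "- 2 * a * B f f \<le> - 2 * a * ?N"
    using assms B_le[OF f] by (intro mult_left_mono) auto
  moreover have "(1 - a)\<^sup>2 * ?N = ?N + (- 2 * a * ?N) + a\<^sup>2 * ?N"
    by (simp add: power2_eq_square algebra_simps)
  ultimately show ?thesis
    unfolding integral_norm_q by linarith
qed

lemma integral_norm_of_eigenfunction:
  assumes a: "a < 1" and lam: "l \<le> 1" "0 \<le> l" and ev: "AE x in U. T q x = l *\<^sub>R q x"
  shows "(\<integral>x. (norm (f x))\<^sup>2 \<partial>U) = (1 / (1 - a * l))\<^sup>2 * (\<integral>x. (norm (q x))\<^sup>2 \<partial>U)"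
proof -
  define c where "c = 1 / (1 - a * l)"
  have "a * l < 1"
  proof (cases "0 \<le> a")
    case True
    then show ?thesis using mult_left_mono[OF lam(1) True] a by simp
  next
    case False
    then show ?thesis using mult_nonpos_nonneg[of a l] lam by simp
  qed
  \<comment> \<open>Exactly the condition for c q to solve the equation when T q = l q. The
    difference from \<open>f\<close> is then a homogeneous solution.\<close>
  then have c: "c = 1 + a * (c * l)" by (simp add: c_def field_simps)
  have cq: "L2 (\<lambda>x. c *\<^sub>R q x)"
    using q_L2 by (rule square_integrable_vec_scaleR)
  have "AE x in U. f x - c *\<^sub>R q x = a *\<^sub>R T (\<lambda>x. f x - c *\<^sub>R q x) x"
    using f_eq ev AE_space
  proof eventually_elim
    case (elim x)
    have "T (\<lambda>x. f x - c *\<^sub>R q x) x = T f x - (c * l) *\<^sub>R q x"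
      using elim by (simp add: T_diff[OF f cq] T_scaleR)
    moreover have "c *\<^sub>R q x = q x + (a * (c * l)) *\<^sub>R q x"
      using c by (metis scaleR_add_left scaleR_one)
    ultimately show ?case
      using elim by (simp add: scaleR_diff_right)
  qed
  then have "AE x in U. f x - c *\<^sub>R q x = 0"
    by (rule homogeneous_solution_zero[OF a square_integrable_vec_diff[OF f cq]])
  then have "(\<integral>x. (norm (f x))\<^sup>2 \<partial>U) = (\<integral>x. c\<^sup>2 * (norm (q x))\<^sup>2 \<partial>U)"
    using square_integrable_vec_measurable[OF f] square_integrable_vec_measurable[OF q_L2]
    by (intro integral_cong_AE) (auto simp: power_mult_distrib)
  then show ?thesis
    by (simp add: c_def)
qed

end

end

section \<open>Correlation matrices of Gaussian signals\<close>

lemma (in prob_space) normal_variable_square_integrable: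
  assumes X: "normal_variable M X"
  shows "X \<in> borel_measurable M" "integrable M (\<lambda>\<omega>. (X \<omega>)\<^sup>2)"
proof -
  show [measurable]: "X \<in> borel_measurable M"
    using X by (auto simp: normal_variable_def dest: distributed_measurable)
  consider (normal) \<mu> \<sigma> where "0 < \<sigma>" "distributed M lborel X (normal_density \<mu> \<sigma>)"
    | (const) \<mu> where "AE \<omega> in M. X \<omega> = \<mu>"
    using X by (auto simp: normal_variable_def)
  then show "integrable M (\<lambda>\<omega>. (X \<omega>)\<^sup>2)"
  proof cases
    case normal
    \<comment> \<open>Expansion of x^2 about \<mu>, since \<open>integrable_normal_moment\<close>
      concerns central moments.\<close>
    have "integrable lborel (\<lambda>x. normal_density \<mu> \<sigma> x * (x - \<mu>)^2 + 2 * \<mu> * (normal_density \<mu> \<sigma> x * (x - \<mu>)^1)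
        + \<mu>^2 * (normal_density \<mu> \<sigma> x * (x - \<mu>)^0))"
      using normal(1) by (intro Bochner_Integration.integrable_add integrable_mult_right integrable_normal_moment)
    then have "integrable lborel (\<lambda>x. normal_density \<mu> \<sigma> x * x\<^sup>2)"
      by (simp add: power2_eq_square algebra_simps)
    then show ?thesis
      using distributed_integrable[OF normal(2), of "\<lambda>x. x\<^sup>2"] by simp
  next
    case const
    have "integrable M (\<lambda>\<omega>. (X \<omega>)\<^sup>2) \<longleftrightarrow> integrable M (\<lambda>\<omega>. \<mu>\<^sup>2)"
      using const by (intro integrable_cong_AE) auto
    then show ?thesis by simp
  qed
qed

text \<open>A non-integrable product would have integral 0 by convention, so bilinearity of
  \<open>covariance\<close> rests on this.\<close>

lemma (in prob_space) covariance_integrable: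
  fixes X Y :: "'a \<Rightarrow> real"
  assumes X: "X \<in> borel_measurable M" "integrable M (\<lambda>\<omega>. (X \<omega>)\<^sup>2)"
    and Y: "Y \<in> borel_measurable M" "integrable M (\<lambda>\<omega>. (Y \<omega>)\<^sup>2)"
  shows "integrable M (\<lambda>\<omega>. (X \<omega> - expectation X) * (Y \<omega> - expectation Y))"
proof -
  have sq: "square_integrable_vec M (\<lambda>\<omega>. Z \<omega> - expectation Z)"
    if "Z \<in> borel_measurable M" "integrable M (\<lambda>\<omega>. (Z \<omega>)\<^sup>2)" for Z :: "'a \<Rightarrow> real"
    using that by (intro square_integrable_vec_diff) (auto simp: square_integrable_vec_def)
  show ?thesis
    using integrable_inner[OF sq[OF X] sq[OF Y]] by simp
qed

lemma covariance_commute: "covariance M X Y = covariance M Y X"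
  by (simp add: covariance_def mult.commute)

locale gaussian_signals = prob_space M for M :: "'w measure" +
  fixes S :: "real \<Rightarrow> 'w \<Rightarrow> real ^ 'd"
  assumes normal: "i \<in> {0..1} \<Longrightarrow> normal_variable M (\<lambda>\<omega>. S i \<omega> $ k)"
    and invertible_cov: "i \<in> {0..1} \<Longrightarrow> invertible (signal_cov M S i i)"
begin

lemma signal_cov_transpose: "signal_cov M S j i = transpose (signal_cov M S i j)"
  by (simp add: signal_cov_def transpose_def vec_eq_iff covariance_commute)

text \<open>Covariance of the scalar combinations u \<bullet> S(i) and v \<bullet> S(j). The
  \<open>has_bochner_integral\<close> form carries integrability along, so that such terms can be
  summed.\<close>

lemma inner_signal_cov:
  assumes i: "i \<in> {0..1}" and j: "j \<in> {0..1}"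
  defines "D \<equiv> \<lambda>i \<omega>. S i \<omega> - (\<chi> k. expectation (\<lambda>\<omega>. S i \<omega> $ k))"
  shows "has_bochner_integral M (\<lambda>\<omega>. (u \<bullet> D i \<omega>) * (v \<bullet> D j \<omega>)) (u \<bullet> (signal_cov M S i j *v v))"
proof -
  have int: "has_bochner_integral M (\<lambda>\<omega>. (S i \<omega> $ k - expectation (\<lambda>\<omega>. S i \<omega> $ k)) *
      (S j \<omega> $ l - expectation (\<lambda>\<omega>. S j \<omega> $ l)))
      (covariance M (\<lambda>\<omega>. S i \<omega> $ k) (\<lambda>\<omega>. S j \<omega> $ l))" for k l
    using covariance_integrable normal_variable_square_integrable normal[OF i, of k] normal[OF j, of l]
    unfolding covariance_def by (intro has_bochner_integral_integrable) blast
  have "has_bochner_integral M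
      (\<lambda>\<omega>. \<Sum>k\<in>UNIV. \<Sum>l\<in>UNIV. (u $ k * v $ l) * ((S i \<omega> $ k - expectation (\<lambda>\<omega>. S i \<omega> $ k)) *
      (S j \<omega> $ l - expectation (\<lambda>\<omega>. S j \<omega> $ l))))
      (\<Sum>k\<in>UNIV. \<Sum>l\<in>UNIV. (u $ k * v $ l) * covariance M (\<lambda>\<omega>. S i \<omega> $ k) (\<lambda>\<omega>. S j \<omega> $ l))"
    by (intro has_bochner_integral_sum has_bochner_integral_mult_right int)
  moreover have "(u \<bullet> D i \<omega>) * (v \<bullet> D j \<omega>) =
      (\<Sum>k\<in>UNIV. \<Sum>l\<in>UNIV. (u $ k * v $ l) * ((S i \<omega> $ k - expectation (\<lambda>\<omega>. S i \<omega> $ k)) *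
      (S j \<omega> $ l - expectation (\<lambda>\<omega>. S j \<omega> $ l))))" for \<omega>
    unfolding inner_vec_def sum_product by (simp add: D_def mult_ac)
  moreover have "u \<bullet> (signal_cov M S i j *v v) =
      (\<Sum>k\<in>UNIV. \<Sum>l\<in>UNIV. (u $ k * v $ l) * covariance M (\<lambda>\<omega>. S i \<omega> $ k) (\<lambda>\<omega>. S j \<omega> $ l))"
    by (simp add: inner_vec_def signal_cov_def matrix_vector_mult_def sum_distrib_left mult_ac)
  ultimately show ?thesis
    by simp
qed

(* The quadratic form is the variance of a linear combination of signals. *)
lemma signal_cov_pos_semidef:
  fixes n :: nat
  assumes z: "\<And>k. k < n \<Longrightarrow> z k \<in> {0..1}"
  shows "0 \<le> (\<Sum>k<n. \<Sum>l<n. v k \<bullet> (signal_cov M S (z k) (z l) *v v l))"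
proof -
  define D where "D i \<omega> = S i \<omega> - (\<chi> k. expectation (\<lambda>\<omega>. S i \<omega> $ k))" for i \<omega>
  have "has_bochner_integral M (\<lambda>\<omega>. \<Sum>k<n. \<Sum>l<n. (v k \<bullet> D (z k) \<omega>) * (v l \<bullet> D (z l) \<omega>))
      (\<Sum>k<n. \<Sum>l<n. v k \<bullet> (signal_cov M S (z k) (z l) *v v l))"
    unfolding D_def by (intro has_bochner_integral_sum inner_signal_cov z) auto
  from has_bochner_integral_integral_eq[OF this]
  have "(\<Sum>k<n. \<Sum>l<n. v k \<bullet> (signal_cov M S (z k) (z l) *v v l)) =
      (\<integral>\<omega>. (\<Sum>k<n. \<Sum>l<n. (v k \<bullet> D (z k) \<omega>) * (v l \<bullet> D (z l) \<omega>)) \<partial>M)" ..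
  \<comment> \<open>The double sum is the square of a single sum over k.\<close>
  moreover have "0 \<le> (\<Sum>k<n. \<Sum>l<n. (v k \<bullet> D (z k) \<omega>) * (v l \<bullet> D (z l) \<omega>))" for \<omega>
    by (simp flip: sum_product)
  ultimately show ?thesis
    by (simp only: Bochner_Integration.integral_nonneg)
qed

lemma signal_cov_diag_pos_semidef:
  assumes i: "i \<in> {0..1}"
  shows "pos_semidef_matrix (signal_cov M S i i)"
proof -
  have "0 \<le> x \<bullet> (signal_cov M S i i *v x)" for x
    using signal_cov_pos_semidef[of 1 "\<lambda>_. i" "\<lambda>_. x"] i by simp
  then show ?thesis
    by (simp add: pos_semidef_matrix_def signal_cov_transpose[symmetric])
qed

lemma transpose_sqrt_inv_cov:
  assumes i: "i \<in> {0..1}"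
  shows "transpose (matrix_sqrt (matrix_inv (signal_cov M S i i))) =
    matrix_sqrt (matrix_inv (signal_cov M S i i))"
  using matrix_sqrt(1)[OF pos_semidef_matrix_inv[OF signal_cov_diag_pos_semidef[OF i] invertible_cov[OF i]]]
  by (simp add: pos_semidef_matrix_def)

lemma signal_corr_diag: "i \<in> {0..1} \<Longrightarrow> signal_corr M S i i = mat 1"
  unfolding signal_corr_def
  by (intro sqrt_inv_conjugate signal_cov_diag_pos_semidef invertible_cov)

lemma signal_corr_transpose:
  assumes "i \<in> {0..1}" "j \<in> {0..1}"
  shows "signal_corr M S j i = transpose (signal_corr M S i j)"
  using assms by (simp add: signal_corr_def matrix_transpose_mul transpose_sqrt_inv_cov
      matrix_mul_assoc signal_cov_transpose[of i j])

text \<open>The normalising roots are symmetric, so they move onto the test vectors and leave the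
  covariance form.\<close>

lemma signal_corr_pos_semidef:
  fixes n :: nat
  assumes z: "\<And>k. k < n \<Longrightarrow> z k \<in> {0..1}"
  shows "0 \<le> (\<Sum>k<n. \<Sum>l<n. v k \<bullet> (signal_corr M S (z k) (z l) *v v l))"
proof -
  define R where "R i = matrix_sqrt (matrix_inv (signal_cov M S i i))" for i
  have "v k \<bullet> (signal_corr M S (z k) (z l) *v v l) =
      (R (z k) *v v k) \<bullet> (signal_cov M S (z k) (z l) *v (R (z l) *v v l))" if "k < n" for k l
  proof -
    have "u \<bullet> (R (z k) *v w) = (R (z k) *v u) \<bullet> w" for u w
      using transpose_sqrt_inv_cov[OF z[OF that]] unfolding transpose_eq_iff_self_adjoint R_def by blast
    then show ?thesis
      by (simp add: signal_corr_def R_def matrix_vector_mul_assoc[symmetric])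
  qed
  then show ?thesis
    using signal_cov_pos_semidef[of n z "\<lambda>k. R (z k) *v v k", OF z] by simp
qed

end

section \<open>The completed product measure on the unit square\<close>

lemma prob_space_agents: "prob_space agents"
  by (intro prob_spaceI) (simp add: emeasure_restrict_space)

lemma complete_measure_agents: "complete_measure agents"
proof
  fix A B :: "real set"
  assume "B \<subseteq> A" and A: "A \<in> null_sets agents"
  then have "A \<in> null_sets lebesgue"
    by (simp add: null_sets_restrict_space)
  then have "B \<in> sets lebesgue"
    using \<open>B \<subseteq> A\<close> by (rule completion.complete[rotated])
  moreover have "B \<subseteq> {0..1}"
    using \<open>B \<subseteq> A\<close> sets.sets_into_space[of A agents] A by auto
  ultimately show "B \<in> sets agents"
    by (simp add: sets_restrict_space_iff)
qed

lemma borel_measurable_agents: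
  assumes "f \<in> borel_measurable borel"
  shows "f \<in> borel_measurable agents"
  using assms by (intro measurable_restrict_space1 measurable_completion) simp

lemma measurable_agents_pair_borel:
  "f \<in> borel_measurable (borel :: (real \<times> real) measure) \<Longrightarrow> f \<in> borel_measurable (agents \<Otimes>\<^sub>M agents)"
proof -
  assume f: "f \<in> borel_measurable (borel :: (real \<times> real) measure)"
  have [measurable]: "(\<lambda>x. x) \<in> borel_measurable agents"
    by (rule borel_measurable_agents) simp
  have "(\<lambda>z. (fst z, snd z)) \<in> borel_measurable (agents \<Otimes>\<^sub>M agents)"
    by (intro borel_measurable_Pair measurable_compose[OF measurable_fst] measurable_compose[OF measurable_snd]) measurable
  from measurable_compose[OF this f] show ?thesis by simp
qed

lemma AE_agents:
  assumes "AE x in lborel. Q x"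
  shows "AE x in agents. Q x"
proof -
  have "AE x in lebesgue. Q x"
    using assms by (rule AE_completion)
  then show ?thesis
    by (subst AE_restrict_space_iff) auto
qed

lemma unit_square_lebesgue: "({0..1} \<times> {0..1} :: (real \<times> real) set) \<in> sets lebesgue"
  by (intro sets_completionI_sets) (simp add: borel_closed closed_Times)

lemma AE_agent_pairs_iff:
  "(AE z in agent_pairs. Q z) \<longleftrightarrow> (AE z in lborel. z \<in> {0..1} \<times> {0..1} \<longrightarrow> Q z)"
  by (subst AE_restrict_space_iff) (use unit_square_lebesgue in \<open>simp_all add: AE_completion_iff\<close>)

(* The completed square measure has more measurable sets than the product of the two agent
   measures, so null sets are first enlarged to Borel null sets. *)
lemma AE_agent_pairs:
  assumes "AE (x, y) in agent_pairs. Q x y"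
  shows "AE (x, y) in agents \<Otimes>\<^sub>M agents. Q x y"
    "AE x in agents. AE y in agents. Q x y"
proof -
  interpret A: prob_space agents by (rule prob_space_agents)
  interpret pair: pair_sigma_finite agents agents ..
  have "AE z in lborel. z \<in> {0..1} \<times> {0..1} \<longrightarrow> Q (fst z) (snd z)"
    using assms by (simp only: AE_agent_pairs_iff split_beta)
  then obtain N where N: "N \<in> null_sets lborel"
    "\<And>z. z \<notin> N \<Longrightarrow> z \<in> {0..1} \<times> {0..1} \<Longrightarrow> Q (fst z) (snd z)"
    by (elim AE_E3) auto
  have "AE z in lborel \<Otimes>\<^sub>M lborel. z \<notin> N"
    unfolding lborel_prod by (rule AE_not_in[OF N(1)])
  from lborel_pair.AE_pair[OF this] have "AE x in lborel. AE y in lborel. (x, y) \<notin> N" .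
  then have "AE x in lborel. AE y in agents. (x, y) \<notin> N"
    by eventually_elim (rule AE_agents)
  then have it: "AE x in agents. AE y in agents. (x, y) \<notin> N"
    by (rule AE_agents)
  have "N \<in> sets borel" using N(1) by auto
  then have "(\<lambda>z. z \<in> N) \<in> measurable borel (count_space UNIV)"
    by simp
  then have "(\<lambda>z. indicator N z :: real) \<in> borel_measurable (agents \<Otimes>\<^sub>M agents)"
    by (intro measurable_agents_pair_borel) simp
  then have "{z \<in> space (agents \<Otimes>\<^sub>M agents). indicator N z \<noteq> (1::real)} \<in> sets (agents \<Otimes>\<^sub>M agents)"
    by measurable
  also have "{z \<in> space (agents \<Otimes>\<^sub>M agents). indicator N z \<noteq> (1::real)} =
      {z \<in> space (agents \<Otimes>\<^sub>M agents). z \<notin> N}"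
    by (auto simp: indicator_def)
  \<comment> \<open>Null sections give a null set in the product only when the exceptional set is
    measurable there, which holds because \<open>N\<close> is Borel.\<close>
  finally have "AE z in agents \<Otimes>\<^sub>M agents. z \<notin> N"
    using it by (rule pair.AE_pair_measure)
  then show *: "AE (x, y) in agents \<Otimes>\<^sub>M agents. Q x y"
    using AE_space by eventually_elim (use N(2) in \<open>auto simp: space_pair_measure\<close>)
  then show "AE x in agents. AE y in agents. Q x y"
    using pair.AE_pair[OF *] by simp
qed

text \<open>A Borel function remains measurable for the uncompleted product of the agent measures,
  so it can serve as the version \<open>p\<close> of the kernel.\<close>

lemma agent_pairs_borel_version:
  fixes F :: "real \<times> real \<Rightarrow> 'b::euclidean_space"
  assumes F: "F \<in> borel_measurable agent_pairs"
  obtains G where "G \<in> borel_measurable borel" "AE z in agent_pairs. G z = F z"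
proof -
  have "\<exists>g\<in>borel_measurable borel. AE z in lborel. indicator ({0..1} \<times> {0..1}) z * (F z \<bullet> b) = g z" for b
  proof -
    have "(\<lambda>z. F z \<bullet> b) \<in> borel_measurable agent_pairs"
      using F by simp
    \<comment> \<open>Extension by zero makes each coordinate Lebesgue measurable on the whole
      plane, where it has a Borel version.\<close>
    then have "(\<lambda>z. indicator ({0..1} \<times> {0..1}) z *\<^sub>R (F z \<bullet> b)) \<in> borel_measurable lebesgue"
      by (subst (asm) borel_measurable_restrict_space_iff)
        (use unit_square_lebesgue in \<open>simp_all add: mult.commute\<close>)
    from completion_ex_borel_measurable_real[OF this] show ?thesis by simp
  qed
  then have "\<forall>b. \<exists>g. g \<in> borel_measurable borel \<and>
      (AE z in lborel. indicator ({0..1} \<times> {0..1}) z * (F z \<bullet> b) = g z)"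
    by blast
  from choice[OF this] obtain g where g: "\<And>b. g b \<in> borel_measurable borel"
    "\<And>b. AE z in lborel. indicator ({0..1} \<times> {0..1}) z * (F z \<bullet> b) = g b z"
    by blast
  show thesis
  proof
    show "(\<lambda>z. \<Sum>b\<in>Basis. g b z *\<^sub>R b) \<in> borel_measurable borel"
      using g(1) by measurable
    have "AE z in lborel. \<forall>b\<in>(Basis :: 'b set). indicator ({0..1} \<times> {0..1}) z * (F z \<bullet> b) = g b z"
      using g(2) by (intro AE_finite_allI) auto
    then show "AE z in agent_pairs. (\<Sum>b\<in>Basis. g b z *\<^sub>R b) = F z"
      unfolding AE_agent_pairs_iff
    proof eventually_elim
      case (elim z)
      show ?case
      proof
        assume "z \<in> {0..1} \<times> {0..1}"
        then have "g b z = F z \<bullet> b" if "b \<in> Basis" for b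
          using elim that by simp
        then show "(\<Sum>b\<in>Basis. g b z *\<^sub>R b) = F z"
          by (simp add: euclidean_representation)
      qed
    qed
  qed
qed

lemma square_integrable_vec_components:
  fixes f :: "'a \<Rightarrow> real ^ 'n"
  assumes f: "\<And>k. square_integrable N (\<lambda>x. f x $ k)"
  shows "square_integrable_vec N f"
proof -
  have "f \<in> borel_measurable N"
    unfolding borel_measurable_euclidean_space[of f]
    using f by (auto simp: square_integrable_def Basis_vec_def inner_axis)
  moreover have "integrable N (\<lambda>x. \<Sum>k\<in>UNIV. (f x $ k)\<^sup>2)"
    using f by (auto simp: square_integrable_def)
  moreover have "(norm v)\<^sup>2 = (\<Sum>k\<in>UNIV. (v $ k)\<^sup>2)" for v :: "real ^ 'n"
    unfolding power2_norm_eq_inner by (simp add: inner_vec_def power2_eq_square)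
  ultimately show ?thesis
    by (simp add: square_integrable_vec_def)
qed

section \<open>Payoff-symmetric equilibria\<close>

theorem proposition3:
  fixes M :: "'w measure"
    and \<theta> :: "'w \<Rightarrow> real"
    and S :: "real \<Rightarrow> 'w \<Rightarrow> real ^ 'd"
    and \<mu>\<^sub>\<theta> \<sigma>\<^sub>\<theta> a :: real
    and w :: "real \<Rightarrow> real \<Rightarrow> real"
    and b c \<phi>\<^sub>0 :: "real \<Rightarrow> real"
    and P :: "real \<Rightarrow> real \<Rightarrow> real ^ 'd ^ 'd"
    and P\<^sub>\<theta> \<phi> q :: "real \<Rightarrow> real ^ 'd"
  assumes "0 < \<sigma>\<^sub>\<theta>"
    and "information_structure M \<mu>\<^sub>\<theta> \<sigma>\<^sub>\<theta> \<theta> S"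
    and "P = signal_corr M S"
    and "P\<^sub>\<theta> = state_corr M \<sigma>\<^sub>\<theta> \<theta> S"
    and "payoff_structure w b c"
    and "affine_equilibrium \<mu>\<^sub>\<theta> \<sigma>\<^sub>\<theta> w b c P P\<^sub>\<theta> \<phi>\<^sub>0 \<phi>"
    and "payoff_symmetric w a"
    and "\<forall>i\<in>{0..1}. q i = (\<sigma>\<^sub>\<theta> * b i) *\<^sub>R P\<^sub>\<theta> i"
  shows "(0 \<le> a \<longrightarrow>
            (\<integral>i. (norm (\<phi> i))\<^sup>2 \<partial>agents) \<ge> (\<integral>i. (norm (q i))\<^sup>2 \<partial>agents) \<and>
            (a = 0 \<or> (AE i in agents. (\<integral>j. P i j *v q j \<partial>agents) = 0) \<longrightarrow>
              (\<integral>i. (norm (\<phi> i))\<^sup>2 \<partial>agents) = (\<integral>i. (norm (q i))\<^sup>2 \<partial>agents))) \<and>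
         (a < 0 \<longrightarrow>
            (\<integral>i. (norm (\<phi> i))\<^sup>2 \<partial>agents) \<ge> (1 / (1 - a))\<^sup>2 * (\<integral>i. (norm (q i))\<^sup>2 \<partial>agents) \<and>
            ((AE i in agents. (\<integral>j. P i j *v q j \<partial>agents) = q i) \<longrightarrow>
              (\<integral>i. (norm (\<phi> i))\<^sup>2 \<partial>agents) = (1 / (1 - a))\<^sup>2 * (\<integral>i. (norm (q i))\<^sup>2 \<partial>agents)))"
proof -
  note info = assms(2)[unfolded information_structure_def]
  note eqm = assms(6)[unfolded affine_equilibrium_def]
  have "normal_variable M (\<lambda>\<omega>. S i \<omega> $ k)" if i: "i \<in> {0..1}" for i k
  proof -
    have "multivariate_normal M {Signal i k} (all_variables \<theta> S)"
      using info i unfolding gaussian_process_def by auto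
    from this[unfolded multivariate_normal_def, rule_format, of "\<lambda>_. 1"] show ?thesis
      by simp
  qed
  then interpret signals: gaussian_signals M S
    using info by (auto simp: gaussian_signals_def gaussian_signals_axioms_def)
  obtain G where G: "G \<in> borel_measurable borel"
    "AE z in agent_pairs. G z = (case z of (i, j) \<Rightarrow> P i j)"
    using agent_pairs_borel_version[of "\<lambda>(i, j). P i j"] info assms(3) by auto
  interpret agents: prob_space agents by (rule prob_space_agents)
  interpret agents: complete_measure agents by (rule complete_measure_agents)
  interpret correlation_kernel agents P "curry G"
  proof unfold_locales
    show "(\<lambda>(i, j). curry G i j) \<in> borel_measurable (agents \<Otimes>\<^sub>M agents)"
      using measurable_agents_pair_borel[OF G(1)] by simp
    show "AE (i, j) in agents \<Otimes>\<^sub>M agents. curry G i j = P i j"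
      using G(2) by (intro AE_agent_pairs(1)) (simp add: split_beta)
    show "P i \<in> borel_measurable agents" if "i \<in> space agents" for i
      using info that by (simp add: assms(3))
    show "P i i = mat 1" if "i \<in> space agents" for i
      using signals.signal_corr_diag that by (simp add: assms(3))
    show "P j i = transpose (P i j)" if "i \<in> space agents" "j \<in> space agents" for i j
      using that unfolding assms(3) by (intro signals.signal_corr_transpose) simp_all
    show "0 \<le> (\<Sum>k<n::nat. \<Sum>l<n. v k \<bullet> (P (z k) (z l) *v v l))"
      if "\<And>k. k < n \<Longrightarrow> z k \<in> space agents" for n z v
      using that unfolding assms(3) by (intro signals.signal_corr_pos_semidef) simp
  qed
  have a: "a < 1"
    using assms(7) by (simp add: payoff_symmetric_def)
  have \<phi>: "L2 \<phi>"
    using eqm by (intro square_integrable_vec_components) simp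
  have "AE (i, j) in agent_pairs. w i j = a"
    using assms(7) by (simp add: payoff_symmetric_def)
  \<comment> \<open>The weight equals \<open>a\<close> only at almost all pairs, so the constant can
    be pulled out only for almost every agent.\<close>
  from AE_agent_pairs(2)[OF this] AE_space
  have \<phi>_eq: "AE i in agents. \<phi> i = a *\<^sub>R T \<phi> i + q i"
  proof eventually_elim
    case (elim i)
    then have i: "i \<in> {0..1}" by simp
    have [measurable]: "w i \<in> borel_measurable agents"
      using assms(5) i by (simp add: payoff_structure_def square_integrable_def)
    note [measurable] = borel_measurable_integrable[OF section_integrable[OF \<phi> elim(2)]]
    have "(\<integral>j. w i j *\<^sub>R (P i j *v \<phi> j) \<partial>agents) = (\<integral>j. a *\<^sub>R (P i j *v \<phi> j) \<partial>agents)"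
      using elim(1) by (intro integral_cong_AE) auto
    then show ?case
      using eqm i assms(8) by (simp add: T_def)
  qed
  show ?thesis
  proof (intro conjI impI)
    assume "0 \<le> a"
    then show "(\<integral>i. (norm (q i))\<^sup>2 \<partial>agents) \<le> (\<integral>i. (norm (\<phi> i))\<^sup>2 \<partial>agents)"
      using integral_norm_q_le_of_nonneg[OF \<phi> \<phi>_eq _ a] by simp
  next
    assume "a = 0 \<or> (AE i in agents. (\<integral>j. P i j *v q j \<partial>agents) = 0)"
    then show "(\<integral>i. (norm (\<phi> i))\<^sup>2 \<partial>agents) = (\<integral>i. (norm (q i))\<^sup>2 \<partial>agents)"
    proof
      assume "a = 0"
      then show ?thesis using integral_norm_q[OF \<phi> \<phi>_eq] by simp
    next
      assume "AE i in agents. (\<integral>j. P i j *v q j \<partial>agents) = 0"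
      \<comment> \<open>Eigenvalue 0 gives the factor 1 / (1 - a * 0) = 1.\<close>
      then show ?thesis
        using integral_norm_of_eigenfunction[OF \<phi> \<phi>_eq a, of 0] by (simp add: T_def)
    qed
  next
    assume neg: "a < 0"
    then have "(\<integral>i. (norm (q i))\<^sup>2 \<partial>agents) \<le> (1 - a)\<^sup>2 * (\<integral>i. (norm (\<phi> i))\<^sup>2 \<partial>agents)"
      using integral_norm_q_le_of_nonpos[OF \<phi> \<phi>_eq] by simp
    then show "(1 / (1 - a))\<^sup>2 * (\<integral>i. (norm (q i))\<^sup>2 \<partial>agents) \<le> (\<integral>i. (norm (\<phi> i))\<^sup>2 \<partial>agents)"
      using a by (simp add: power_divide divide_simps mult.commute)
  next
    assume "AE i in agents. (\<integral>j. P i j *v q j \<partial>agents) = q i"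
    then show "(\<integral>i. (norm (\<phi> i))\<^sup>2 \<partial>agents) = (1 / (1 - a))\<^sup>2 * (\<integral>i. (norm (q i))\<^sup>2 \<partial>agents)"
      using integral_norm_of_eigenfunction[OF \<phi> \<phi>_eq a, of 1] by (simp add: T_def)
  qed
qed

end
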